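(* Let $\mathbb{F}_q$ be the finite field with $q$ elements, of characteristic $p$, and let $f(x)\in\mathbb{F}_q[x]$ be a polynomial of degree $d$ with $d$ not divisible by $p$. Let $D\subseteq\mathbb{F}_q$ be a subset with $|D|=q-c\geq (d-1)\sqrt{q}+c$, let $b\in\mathbb{F}_q$, let $k$ be an integer with $0\le k\le|D|$, and let $N_f(D,k,b)$ be the number of $k$-element subsets $S\subseteq D$ such that $\sum_{x\in S}f(x)=b$. Then $$\left| N_f(D, k, b)-\frac{1}{q}\binom{q-c}{k}\right|\leq \binom{\frac{q-c}{p}+\frac{p-1}{p}\left((d-1)q^{\frac 12}+c\right)+k-1}{k}.$$
   Context: For a real number $x$ and an integer $k\ge 0$, $\binom{x}{k}=\frac{(x)_k}{k!}$ with $(x)_0=1$ and $(x)_k=x(x-1)\cdots(x-k+1)$ for $k\geq 1$. *)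

theory Defs
  imports Complex_Main "HOL-Library.Cardinality" "HOL-Computational_Algebra.Computational_Algebra"
begin

definition subset_sum_count :: "'a::{finite,field} poly \<Rightarrow> 'a set \<Rightarrow> nat \<Rightarrow> 'a \<Rightarrow> nat" where
  "subset_sum_count f D k b =
     card {S. S \<subseteq> D \<and> card S = k \<and> (\<Sum>x\<in>S. poly f x) = b}"

end

theory Submission
  imports "HOL-Algebra.Algebraic_Closure_Type" Defs
begin

text \<open>
  Expanding \<open>N\<^sub>f(D, k, b)\<close> over the additive characters \<open>y \<mapsto> \<psi> (a * y)\<close>, the trivial character
  contributes the main term, and \<open>a \<noteq> 0\<close> contributes the \<open>k\<close>-th elementary symmetric function of the
  values \<open>\<psi> (a * f(x))\<close>, \<open>x \<in> D\<close>. Their \<open>i\<close>-th power sum is \<open>|D|\<close> if \<open>p\<close> divides \<open>i\<close>, and otherwise it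
  is at most \<open>M = (d - 1) \<surd>q + c\<close> by Weil's bound. Newton's identities then majorise the symmetric function by
  the coefficient of \<open>t^k\<close> in \<open>(1 - t)^(-M) (1 - t^p)^(-s)\<close> with \<open>s = (|D| - M) / p\<close>, which is at most
  that of \<open>(1 - t)^(-(M + s))\<close>, the claimed binomial coefficient.

  For Weil's bound, let \<open>c\<^sub>n\<close> be the sum over all monic \<open>g\<close> of degree \<open>n\<close> of \<open>\<psi>\<close> applied to the sum of
  \<open>f\<close> over the roots of \<open>g\<close>. Since \<open>p\<close> does not divide \<open>d\<close>, \<open>c\<^sub>n = 0\<close> for \<open>n \<ge> d\<close>, and unique factorisation gives
  \<open>n c\<^sub>n = \<Sum>\<^sub>i S\<^sub>i c\<^sub>n\<^sub>-\<^sub>i\<close>, where \<open>S\<^sub>i\<close> is the character sum of \<open>f\<close> over the extension of degree \<open>i\<close>. Hence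
  \<open>S\<^sub>i\<close> is minus the \<open>i\<close>-th power sum of \<open>d - 1\<close> complex numbers, and these have modulus at most \<open>\<surd>q\<close>
  as soon as \<open>S\<^sub>2\<^sub>m = O(q^m)\<close>. That weaker estimate is obtained by a univariate form of
  Stepanov's method.
\<close>

subsection \<open>Power sums of the roots of a polynomial\<close>

lemma fps_geometric:
  fixes a :: "'b::field"
  shows "(1 - fps_const a * fps_X) * Abs_fps (\<lambda>n. a ^ n) = 1"
proof (rule fps_ext)
  fix n show "((1 - fps_const a * fps_X) * Abs_fps (\<lambda>n. a ^ n)) $ n = (1 :: 'b fps) $ n"
    unfolding left_diff_distrib mult.assoc mult_1_left by (cases n) simp_all
qed

text \<open>Newton's identities in logarithmic form: a factor 1 - a t contributes -a t / (1 - a t),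
  the negated geometric series without its constant term, and contributions add along the
  product.\<close>

lemma fps_X_mult_deriv_prod_mset:
  fixes A :: "'b::field multiset"
  defines "F \<equiv> \<Prod>a\<in>#A. 1 - fps_const a * fps_X"
  shows "fps_X * fps_deriv F = - F * Abs_fps (\<lambda>n. if n = 0 then 0 else \<Sum>a\<in>#A. a ^ n)"
  unfolding F_def
proof (induction A)
  case empty
  have "Abs_fps (\<lambda>n. if n = 0 then 0 else \<Sum>a\<in>#{#}. (a :: 'b) ^ n) = 0"
    by (rule fps_ext) simp
  then show ?case by simp
next
  case (add a A)
  let ?P = "\<Prod>a\<in>#A. 1 - fps_const a * fps_X"
  let ?S = "\<lambda>A. Abs_fps (\<lambda>n. if n = 0 then 0 else \<Sum>a\<in>#A. a ^ n)"
  have S: "?S (add_mset a A) = ?S A + fps_const a * fps_X * Abs_fps (\<lambda>n. a ^ n)"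
  proof (rule fps_ext)
    fix n show "?S (add_mset a A) $ n = (?S A + fps_const a * fps_X * Abs_fps (\<lambda>n. a ^ n)) $ n"
      by (cases n) (simp_all add: mult.assoc fps_X_mult_nth)
  qed
  let ?c = "1 - fps_const a * fps_X"
  have alg1: "w * (c * p' + (- e) * p) = c * (w * p') - e * w * p"
    and alg2: "c * (- p * s) - e * w * p * (c * t) = - (c * p) * (s + e * w * t)" for w c p p' e s t :: "'b fps"
    by (simp_all add: algebra_simps)
  have "fps_deriv ?c = - fps_const a" by simp
  then have "fps_X * fps_deriv (?c * ?P) = ?c * (fps_X * fps_deriv ?P) - fps_const a * fps_X * ?P * (?c * Abs_fps (\<lambda>n. a ^ n))"
    by (simp only: fps_deriv_mult alg1 fps_geometric mult_1_right)
  also have "\<dots> = - (?c * ?P) * ?S (add_mset a A)"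
    unfolding add.IH S by (rule alg2)
  finally show ?case by (simp only: image_mset_add_mset prod_mset.add_mset)
qed

lemma fps_X_mult_deriv_nth: "(fps_X * fps_deriv F) $ n = of_nat n * (F :: 'b::field fps) $ n"
  by (cases n) simp_all

text \<open>
  Minus the logarithmic derivative of the reversed polynomial \<open>\<Prod> (1 - \<alpha> t)\<close>, completed by the degree in order
  \<open>0\<close>: the coefficient of \<open>t^n\<close> is the sum of the \<open>\<alpha>^n\<close> over the roots \<open>\<alpha>\<close> of \<open>g\<close>, without reference to a splitting field.
\<close>
definition power_sums :: "'b::field poly \<Rightarrow> 'b fps" where
  "power_sums g = fps_const (of_nat (degree g))
     - fps_X * fps_deriv (fps_of_poly (reflect_poly g)) * inverse (fps_of_poly (reflect_poly g))"

lemma reflect_poly_inverse: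
  fixes g :: "'b::field poly"
  assumes "g \<noteq> 0"
  shows "inverse (fps_of_poly (reflect_poly g)) * fps_of_poly (reflect_poly g) = 1"
  using assms by (intro inverse_mult_eq_1) simp

lemma power_sums_newton:
  fixes g :: "'b::field poly"
  assumes "g \<noteq> 0"
  defines "R \<equiv> fps_of_poly (reflect_poly g)"
  shows "power_sums g * R = fps_const (of_nat (degree g)) * R - fps_X * fps_deriv R"
proof -
  have "power_sums g * R = fps_const (of_nat (degree g)) * R - fps_X * fps_deriv R * (inverse R * R)"
    by (simp add: power_sums_def R_def algebra_simps)
  then show ?thesis using reflect_poly_inverse[OF assms(1)] by (simp add: R_def)
qed

text \<open>The reversed polynomial is nonzero and can be cancelled, so Newton's identity
  characterises \<open>power_sums g\<close>. The computations below only verify that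
  identity.\<close>

lemma power_sums_unique:
  fixes g :: "'b::field poly"
  assumes "g \<noteq> 0"
  defines "R \<equiv> fps_of_poly (reflect_poly g)"
  assumes "F * R = fps_const (of_nat (degree g)) * R - fps_X * fps_deriv R"
  shows "power_sums g = F"
proof -
  have "R \<noteq> 0" unfolding R_def using assms(1) by (metis fps_of_poly_0 fps_of_poly_eq_iff reflect_poly_eq_0_iff)
  moreover have "power_sums g * R = F * R"
    using power_sums_newton[OF assms(1)] assms(3) by (simp add: R_def)
  ultimately show ?thesis by simp
qed

lemma power_sums_mult:
  fixes g h :: "'b::field poly"
  assumes "g \<noteq> 0" "h \<noteq> 0"
  shows "power_sums (g * h) = power_sums g + power_sums h"
proof (rule power_sums_unique)
  show "g * h \<noteq> 0" using assms by simp
  let ?R = "fps_of_poly (reflect_poly g)" and ?S = "fps_of_poly (reflect_poly h)"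
  have "(power_sums g + power_sums h) * (?R * ?S)
      = (power_sums g * ?R) * ?S + (power_sums h * ?S) * ?R"
    by (simp add: algebra_simps)
  also have "\<dots> = fps_const (of_nat (degree (g * h))) * (?R * ?S) - fps_X * fps_deriv (?R * ?S)"
    unfolding power_sums_newton[OF assms(1)] power_sums_newton[OF assms(2)]
    using assms by (simp add: degree_mult_eq algebra_simps flip: fps_const_add)
  finally show "(power_sums g + power_sums h) * fps_of_poly (reflect_poly (g * h))
     = fps_const (of_nat (degree (g * h))) * fps_of_poly (reflect_poly (g * h))
       - fps_X * fps_deriv (fps_of_poly (reflect_poly (g * h)))"
    by (simp add: reflect_poly_mult fps_of_poly_mult)
qed

lemma power_sums_1 [simp]: "power_sums (1 :: 'b::field poly) = 0"
  by (simp add: power_sums_def)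

lemma power_sums_linear: "power_sums [:-a, 1:] = Abs_fps (\<lambda>n. (a :: 'b::field) ^ n)"
proof (rule power_sums_unique)
  have r: "fps_of_poly (reflect_poly [:-a, 1:]) = 1 - fps_const a * fps_X"
    by (cases "a = 0") (simp_all add: reflect_poly_pCons reflect_poly_pCons' fps_of_poly_linear' flip: fps_const_neg)
  show "Abs_fps ((^) a) * fps_of_poly (reflect_poly [:- a, 1:]) =
    fps_const (of_nat (degree [:- a, 1:])) * fps_of_poly (reflect_poly [:- a, 1:]) -
    fps_X * fps_deriv (fps_of_poly (reflect_poly [:- a, 1:]))"
    unfolding r using fps_geometric[of a] by (simp add: mult.commute)
qed simp

lemma power_sums_split:
  fixes A :: "'b::field multiset"
  shows "power_sums (\<Prod>a\<in>#A. [:-a, 1:]) $ n = (\<Sum>a\<in>#A. a ^ n)"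
proof (induction A)
  case (add a A)
  have "(\<Prod>a\<in>#A. [:-a, 1:]) \<noteq> 0" by (auto simp: prod_mset_zero_iff)
  then show ?case using add by (simp add: power_sums_mult power_sums_linear del: mult_pCons_left)
qed simp

text \<open>Applying \<open>to_ac\<close> to coefficients respects products and derivatives of power
  series, hence Newton's identity. This lets power sums defined over the base field be read off from
  roots in the closure.\<close>

lemma power_sums_map_to_ac:
  fixes g :: "'b::field poly"
  assumes "g \<noteq> 0"
  shows "power_sums (map_poly to_ac g) $ n = to_ac (power_sums g $ n)"
proof -
  let ?m = "\<lambda>F. Abs_fps (\<lambda>n. to_ac (F $ n))"
  have m_mult: "?m (F * G) = ?m F * ?m G" for F G :: "'b fps"
    by (rule fps_ext) (simp add: fps_mult_nth to_ac_sum)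
  have m_diff: "?m (F - G) = ?m F - ?m G" for F G :: "'b fps"
    by (rule fps_ext) simp
  have m_const: "?m (fps_const c) = fps_const (to_ac c)" for c :: 'b
    by (rule fps_ext) simp
  have m_X: "?m fps_X = fps_X" by (rule fps_ext) (simp add: fps_X_def)
  have m_deriv: "?m (fps_deriv F) = fps_deriv (?m F)" for F :: "'b fps"
    by (rule fps_ext) (simp del: of_nat_Suc)
  have m_scale: "?m (fps_const c * F) = fps_const (to_ac c) * ?m F" for c and F :: "'b fps"
    by (simp only: m_mult m_const)
  have m_XD: "?m (fps_X * fps_deriv F) = fps_X * fps_deriv (?m F)" for F :: "'b fps"
    by (simp only: m_mult m_X m_deriv)
  have deg: "degree (map_poly to_ac g) = degree g" by (rule degree_map_poly) simp
  have m_R: "?m (fps_of_poly (reflect_poly g)) = fps_of_poly (reflect_poly (map_poly to_ac g))"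
    by (rule fps_ext) (simp add: coeff_reflect_poly deg coeff_map_poly)
  have "power_sums (map_poly to_ac g) = ?m (power_sums g)"
  proof (rule power_sums_unique)
    show "map_poly to_ac g \<noteq> 0" using assms by (metis deg degree_0 leading_coeff_0_iff coeff_map_poly to_ac_0 to_ac_eq_0_iff coeff_0)
    show "?m (power_sums g) * fps_of_poly (reflect_poly (map_poly to_ac g)) =
      fps_const (of_nat (degree (map_poly to_ac g))) * fps_of_poly (reflect_poly (map_poly to_ac g)) -
      fps_X * fps_deriv (fps_of_poly (reflect_poly (map_poly to_ac g)))"
      unfolding m_R[symmetric] m_mult[symmetric] power_sums_newton[OF assms] m_diff
        m_scale m_XD deg by simp
  qed
  then show ?thesis by simp
qed

text \<open>Reversal turns the added monomial into e t^d. Subtracting the two Newton identities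
  shows that the power sum series differ by a multiple of t^d, whose leading coefficient comes from
  constant terms alone.\<close>

lemma power_sums_perturb:
  fixes g :: "'b::field poly" and e :: 'b
  assumes "lead_coeff g = 1" "0 < d" "d \<le> degree g"
  defines "h \<equiv> g + monom e (degree g - d)"
  shows "degree h = degree g" and "lead_coeff h = 1"
    and "j < d \<Longrightarrow> power_sums h $ j = power_sums g $ j"
    and "power_sums h $ d = power_sums g $ d - of_nat d * e"
proof -
  have lt: "degree (monom e (degree g - d)) < degree g"
    using assms by (intro order.strict_trans1[OF degree_monom_le]) simp
  show deg: "degree h = degree g" unfolding h_def using lt by (rule degree_add_eq_left)
  show lc: "lead_coeff h = 1"
    unfolding deg using assms(1-3) by (simp add: h_def)
  have nz: "g \<noteq> 0" "h \<noteq> 0" using assms(1) lc by auto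
  let ?R = "fps_of_poly (reflect_poly g)" and ?S = "fps_of_poly (reflect_poly h)"
  have ch: "coeff h i = coeff g i + (if i = degree g - d then e else 0)" for i
    by (simp add: h_def)
  have S: "?S = ?R + fps_const e * fps_X ^ d"
  proof (rule fps_ext)
    fix n
    have "degree g - n = degree g - d \<longleftrightarrow> n = d" if "n \<le> degree g"
      using that assms(2,3) by auto
    then show "?S $ n = (?R + fps_const e * fps_X ^ d) $ n"
      using assms(3) by (simp add: coeff_reflect_poly deg fps_X_power_nth ch)
  qed
  let ?D = "power_sums h - power_sums g"
  define T where "T = (fps_const (of_nat (degree g)) - fps_const (of_nat d) - power_sums h) * inverse ?R"
  have Xd: "fps_X * fps_deriv (fps_X ^ d :: 'b fps) = fps_const (of_nat d) * fps_X ^ d"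
    by (rule fps_ext) (simp only: fps_X_mult_deriv_nth, simp add: fps_X_power_nth)
  have elim: "(P - Q) * R = Z * (E * (N - c - P))"
    if "Q * R = N * R - w * r'" "P * (R + E * Z) = N * (R + E * Z) - w * (r' + E * z')" "w * z' = c * Z"
    for P Q R N E Z r' z' w c :: "'b fps"
  proof -
    have "(P - Q) * R = P * (R + E * Z) - P * (E * Z) - Q * R" by (simp only: algebra_simps)
    also have "\<dots> = N * (E * Z) - E * (w * z') - P * (E * Z)"
      unfolding that(1,2) by (simp add: algebra_simps)
    also have "\<dots> = Z * (E * (N - c - P))"
      unfolding that(3) by (simp add: algebra_simps)
    finally show ?thesis .
  qed
  have "fps_deriv ?S = fps_deriv ?R + fps_const e * fps_deriv (fps_X ^ d)"
    unfolding S by (simp only: fps_deriv_add fps_deriv_mult_const_left)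
  with power_sums_newton[OF nz(2), unfolded deg]
  have "power_sums h * (?R + fps_const e * fps_X ^ d) = fps_const (of_nat (degree g)) * (?R + fps_const e * fps_X ^ d)
      - fps_X * (fps_deriv ?R + fps_const e * fps_deriv (fps_X ^ d))"
    unfolding S by (simp only:)
  from elim[OF power_sums_newton[OF nz(1)] this Xd]
  have "?D * ?R = fps_X ^ d * (fps_const e * (fps_const (of_nat (degree g)) - fps_const (of_nat d) - power_sums h))" .
  then have "?D * ?R * inverse ?R = fps_X ^ d * (fps_const e * T)"
    by (simp only: T_def mult.assoc)
  then have D: "?D = fps_X ^ d * (fps_const e * T)"
    using reflect_poly_inverse[OF nz(1)] by (simp only: mult.assoc mult.commute[of ?R] mult_1_right)
  have ps0: "power_sums h $ 0 = of_nat (degree g)" by (simp add: power_sums_def deg)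
  have "?D $ j = 0" if "j < d" for j using that unfolding D by (simp add: fps_X_power_mult_nth)
  then show "j < d \<Longrightarrow> power_sums h $ j = power_sums g $ j" by simp
  \<comment> \<open>The reversed polynomial has constant term 1 and the zeroth power sum is the
    degree, so the constant term of \<open>T\<close> is (degree g - d) - degree g = -d.\<close>
  have "?D $ d = - of_nat d * e"
    unfolding D using assms(1) by (simp add: fps_X_power_mult_nth T_def ps0)
  then show "power_sums h $ d = power_sums g $ d - of_nat d * e"
    by (simp add: algebra_simps)
qed

subsection \<open>Additive characters of finite fields\<close>

lemma prime_CHAR_finite: "prime (CHAR('a::{finite,field}))"
  by (rule prime_CHAR_semidom) (rule finite_imp_CHAR_pos, simp)

lemma CHAR_gt_1_finite: "CHAR('a::{finite,field}) > 1"
  using prime_CHAR_finite prime_gt_1_nat by blast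

text \<open>Multiplication by a nonzero x permutes the nonzero elements, so their product is
  unchanged by the factor x^(q - 1).\<close>

lemma power_CARD_eq_self: "(x :: 'a::{finite,field}) ^ CARD('a) = x"
proof (cases "x = 0")
  case False
  have "x * (\<Prod>y\<in>UNIV-{0}. x * y) = x * x ^ (CARD('a) - 1) * \<Prod>(UNIV-{0})"
    by (simp add: prod.distrib mult_ac)
  also have "x * x ^ (CARD('a) - 1) = x ^ CARD('a)"
    by (subst power_Suc[symmetric]) simp
  also have "(\<Prod>y\<in>UNIV-{0}. x * y) = (\<Prod>y\<in>UNIV-{0}. y)"
    by (rule prod.reindex_bij_witness[of _ "\<lambda>y. y / x" "\<lambda>y. x * y"]) (use False in auto)
  finally show ?thesis by simp
qed simp

lemma power_CARD_power_eq_self: "(x :: 'a::{finite,field}) ^ (CARD('a) ^ n) = x"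
  by (induction n) (simp_all add: power_CARD_eq_self power_mult)

text \<open>The inverse m^(q - 2) is again the image of a natural number, so dividing by m never
  leaves an additive subgroup.\<close>

lemma of_nat_inverse_exists:
  assumes "(of_nat m :: 'a::{finite,field}) \<noteq> 0"
  obtains k where "of_nat k * of_nat m = (1 :: 'a)"
proof -
  have "CARD('a) \<ge> 2"
    using card_mono[of UNIV "{0, 1 :: 'a}"] by simp
  then have "(of_nat m :: 'a) ^ (CARD('a) - 2) * of_nat m * of_nat m = of_nat m ^ CARD('a)"
    by (metis le_add_diff_inverse2 mult.assoc power2_eq_square power_add)
  then have "(of_nat m :: 'a) ^ (CARD('a) - 2) * of_nat m = 1"
    using assms by (simp add: power_CARD_eq_self)
  then show ?thesis using that[of "m ^ (CARD('a) - 2)"] by simp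
qed

section \<open>Additive subgroups and the order of a finite field\<close>

lemma max_card_exists:
  fixes P :: "'a::finite set \<Rightarrow> bool"
  assumes "P A"
  shows "\<exists>V. P V \<and> (\<forall>W. P W \<longrightarrow> card W \<le> card V)"
proof -
  have "\<forall>W. P W \<longrightarrow> card W < Suc (CARD('a))"
    by (simp add: card_mono less_Suc_eq_le)
  from ex_has_greatest_nat[OF assms this] show ?thesis .
qed

text \<open>Closure under negation is automatic here: in characteristic p, -w is the multiple (p -
  1) w.\<close>

definition add_subgroup :: "'a::ring_1 set \<Rightarrow> bool" where
  "add_subgroup V \<longleftrightarrow> 0 \<in> V \<and> (\<forall>x\<in>V. \<forall>y\<in>V. x + y \<in> V)"

lemma add_subgroup_of_nat_mult: "add_subgroup V \<Longrightarrow> v \<in> V \<Longrightarrow> of_nat n * v \<in> V"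
  by (induction n) (auto simp: add_subgroup_def algebra_simps)

lemma add_subgroup_diff:
  fixes V :: "'a::{finite,field} set"
  assumes "add_subgroup V" "v \<in> V" "w \<in> V"
  shows "v - w \<in> V"
proof -
  have "of_nat (CHAR('a) - 1) * w = - w"
    using CHAR_gt_1_finite[where 'a='a] by (simp add: of_nat_diff)
  then show ?thesis
    using add_subgroup_of_nat_mult[OF assms(1,3)] assms(1,2)
    by (metis add_subgroup_def diff_conv_add_uminus)
qed

lemma add_subgroup_divide:
  fixes V :: "'a::{finite,field} set"
  assumes "add_subgroup V" "of_nat m * x \<in> V" "(of_nat m :: 'a) \<noteq> 0"
  shows "x \<in> V"
proof -
  obtain k where "of_nat k * of_nat m = (1 :: 'a)"
    using of_nat_inverse_exists[OF assms(3)] .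
  then show ?thesis
    using add_subgroup_of_nat_mult[OF assms(1,2), of k] by (simp flip: mult.assoc)
qed

text \<open>Multiples of x depend only on j modulo p. A coincidence between two distinct residues
  would put a nonzero multiple of x, hence x itself, into V; so W consists of p disjoint cosets of
  V.\<close>

lemma add_subgroup_extend:
  fixes V :: "'a::{finite,field} set"
  assumes V: "add_subgroup V" and x: "x \<notin> V"
  defines "W \<equiv> (\<lambda>(v, j). v + of_nat j * x) ` (V \<times> {..<CHAR('a)})"
  shows "add_subgroup W" "card W = CHAR('a) * card V"
proof -
  let ?p = "CHAR('a)"
  have mem: "v + of_nat j * x \<in> W" if "v \<in> V" for v j
  proof -
    have "v + of_nat j * x = v + of_nat (j mod ?p) * x"
    proof -
      have "(of_nat j :: 'a) = of_nat (?p * (j div ?p) + j mod ?p)" by simp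
      then have "(of_nat j :: 'a) = of_nat (j mod ?p)"
        by (simp only: of_nat_add of_nat_mult of_nat_CHAR mult_zero_left add_0_left)
      then show ?thesis by simp
    qed
    then show ?thesis
      using that CHAR_gt_1_finite[where 'a='a] by (auto simp: W_def intro!: image_eqI[of _ _ "(v, j mod ?p)"])
  qed
  show "add_subgroup W"
    unfolding add_subgroup_def
  proof (intro conjI ballI)
    show "0 \<in> W" using mem[of 0 0] V by (simp add: add_subgroup_def)
    fix y z assume "y \<in> W" "z \<in> W"
    then obtain v i w j where "v \<in> V" "w \<in> V" "y = v + of_nat i * x" "z = w + of_nat j * x"
      by (auto simp: W_def)
    then show "y + z \<in> W" using mem[of "v + w" "i + j"] V
      by (simp add: add_subgroup_def algebra_simps)
  qed
  have less: False if "v \<in> V" "w \<in> V" "i < j" "j < ?p" "v + of_nat i * x = w + of_nat j * x" for v w i j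
  proof -
    have "of_nat (j - i) * x = v - w"
      using that by (simp add: of_nat_diff algebra_simps)
    moreover have "(of_nat (j - i) :: 'a) \<noteq> 0"
      unfolding of_nat_eq_0_iff_char_dvd using that(3,4) by (auto dest: dvd_imp_le simp del: of_nat_diff)
    ultimately show False
      using add_subgroup_divide[OF V] add_subgroup_diff[OF V that(1,2)] x by metis
  qed
  have "inj_on (\<lambda>(v, j). v + of_nat j * x) (V \<times> {..<?p})"
  proof (rule inj_onI, clarify)
    fix v i w j assume "v \<in> V" "w \<in> V" "i < ?p" "j < ?p" "v + of_nat i * x = w + of_nat j * x"
    moreover from this have "\<not> i < j" "\<not> j < i" using less[of v w i j] less[of w v j i] by metis+
    ultimately show "v = w \<and> i = j" by simp
  qed
  then show "card W = ?p * card V"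
    by (simp add: W_def card_image card_cartesian_product)
qed

text \<open>A largest additive subgroup of p-power order is the whole field, since any missing
  element would enlarge it by the factor p.\<close>

lemma CARD_eq_CHAR_power: "\<exists>s. CARD('a::{finite,field}) = CHAR('a) ^ s"
proof -
  let ?P = "\<lambda>V :: 'a set. add_subgroup V \<and> (\<exists>s. card V = CHAR('a) ^ s)"
  have "?P {0}" by (auto simp: add_subgroup_def intro: exI[of _ 0])
  from max_card_exists[of ?P, OF this] obtain V where *: "?P V \<and> (\<forall>W. ?P W \<longrightarrow> card W \<le> card V)" ..
  then have V: "?P V" and max: "\<And>W. ?P W \<Longrightarrow> card W \<le> card V" by simp_all
  have "V = UNIV"
  proof (rule ccontr)
    assume "V \<noteq> UNIV"
    then obtain x where x: "x \<notin> V" by auto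
    have "card V > 0" using V by (auto simp: card_gt_0_iff add_subgroup_def)
    moreover define W where "W = (\<lambda>(v, j). v + of_nat j * x) ` (V \<times> {..<CHAR('a)})"
    have W: "add_subgroup W" "card W = CHAR('a) * card V"
      unfolding W_def using V x by (simp_all add: add_subgroup_extend)
    moreover have "?P W" using W V by (metis power_Suc)
    ultimately show False using max[of W] CHAR_gt_1_finite[where 'a='a] by simp
  qed
  then show ?thesis using V by auto
qed

section \<open>Additive characters and orthogonality\<close>

definition add_char :: "('a::ring_1 \<Rightarrow> complex) \<Rightarrow> bool" where
  "add_char \<psi> \<longleftrightarrow> (\<forall>x y. \<psi> (x + y) = \<psi> x * \<psi> y) \<and> (\<forall>x. norm (\<psi> x) = 1)"

lemma add_char_add: "add_char \<psi> \<Longrightarrow> \<psi> (x + y) = \<psi> x * \<psi> y"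
  and add_char_norm: "add_char \<psi> \<Longrightarrow> norm (\<psi> x) = 1"
  by (simp_all add: add_char_def)

lemma add_char_0:
  assumes "add_char \<psi>"
  shows "\<psi> 0 = 1"
proof -
  have "\<psi> 0 * \<psi> 0 = \<psi> 0 * 1" using add_char_add[OF assms, of 0 0] by simp
  moreover have "\<psi> 0 \<noteq> 0" using add_char_norm[OF assms, of 0] by auto
  ultimately show ?thesis by (simp only: mult_cancel_left) simp
qed

lemma add_char_sum: "add_char \<psi> \<Longrightarrow> \<psi> (\<Sum>x\<in>A. f x) = (\<Prod>x\<in>A. \<psi> (f x))"
  by (induction A rule: infinite_finite_induct) (simp_all add: add_char_0 add_char_add)

lemma add_char_of_nat_mult: "add_char \<psi> \<Longrightarrow> \<psi> (of_nat n * x) = \<psi> x ^ n"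
  by (induction n) (simp_all add: add_char_0 add_char_add algebra_simps)

lemma add_char_mult_left: "add_char \<psi> \<Longrightarrow> add_char (\<lambda>x. \<psi> (a * x))"
  by (simp add: add_char_def distrib_left)

text \<open>Translating the summation variable by z multiplies the sum by \<open>\<psi> z\<close>,
  which differs from 1.\<close>

lemma add_char_sum_eq_0:
  fixes \<psi> :: "'a::{finite,field} \<Rightarrow> complex"
  assumes "add_char \<psi>" "\<psi> z \<noteq> 1"
  shows "(\<Sum>x\<in>UNIV. \<psi> x) = 0"
proof -
  have "(\<Sum>x\<in>UNIV. \<psi> x) = (\<Sum>x\<in>UNIV. \<psi> (z + x))"
    by (rule sum.reindex_bij_witness[of _ "\<lambda>x. z + x" "\<lambda>x. x - z"]) auto
  also have "\<dots> = \<psi> z * (\<Sum>x\<in>UNIV. \<psi> x)"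
    by (simp add: add_char_add[OF assms(1)] sum_distrib_left)
  finally show ?thesis using assms(2) by simp
qed

lemma add_char_orthogonality:
  fixes \<psi> :: "'a::{finite,field} \<Rightarrow> complex"
  assumes "add_char \<psi>" "\<psi> z \<noteq> 1"
  shows "(\<Sum>a\<in>UNIV. \<psi> (a * x)) = (if x = 0 then of_nat (CARD('a)) else 0)"
proof (cases "x = 0")
  case False
  then have "(\<lambda>a. \<psi> (x * a)) (z / x) \<noteq> 1" using assms(2) by simp
  from add_char_sum_eq_0[OF add_char_mult_left[OF assms(1)] this] show ?thesis
    using False by (simp add: mult.commute)
qed (simp add: add_char_0[OF assms(1)])

text \<open>For a largest additive subgroup V avoiding 1, every x is congruent modulo V to some
  natural number k. Indeed, if x is not in V, the extension by x contains 1 = v + j x, and j can be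
  inverted. The character sends x to the k-th power of a p-th root of unity.\<close>

lemma nontrivial_add_char_exists:
  obtains \<psi> :: "'a::{finite,field} \<Rightarrow> complex" where "add_char \<psi>" "\<psi> 1 \<noteq> 1"
proof -
  let ?p = "CHAR('a)"
  let ?P = "\<lambda>V :: 'a set. add_subgroup V \<and> 1 \<notin> V"
  have "?P {0}" by (auto simp: add_subgroup_def)
  from max_card_exists[of ?P, OF this] obtain V where *: "?P V \<and> (\<forall>W. ?P W \<longrightarrow> card W \<le> card V)" ..
  then have V: "add_subgroup V" "1 \<notin> V" and max: "\<And>W. ?P W \<Longrightarrow> card W \<le> card V" by simp_all
  have ex: "\<exists>k. x - of_nat k \<in> V" for x
  proof (cases "x \<in> V")
    case True
    then show ?thesis by (intro exI[of _ 0]) simp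
  next
    case False
    have "card V > 0" using V by (auto simp: card_gt_0_iff add_subgroup_def)
    let ?W = "(\<lambda>(v, j). v + of_nat j * x) ` (V \<times> {..<?p})"
    have "1 \<in> ?W"
    proof (rule ccontr)
      assume "1 \<notin> ?W"
      with max[of ?W] add_subgroup_extend(1)[OF V(1) False] have "card ?W \<le> card V" by blast
      then have "?p * card V \<le> 1 * card V" unfolding add_subgroup_extend(2)[OF V(1) False] by simp
      then show False using \<open>card V > 0\<close> CHAR_gt_1_finite[where 'a='a] by simp
    qed
    then obtain z where z: "1 = (\<lambda>(v, j). v + of_nat j * x) z" "z \<in> V \<times> {..<?p}" by (rule imageE)
    define v j where "v = fst z" and "j = snd z"
    have vj: "v \<in> V" "1 = v + of_nat j * x"
      using z by (simp_all only: v_def j_def case_prod_beta mem_Times_iff)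
    with V(2) have "(of_nat j :: 'a) \<noteq> 0" by auto
    then obtain k where k: "of_nat k * of_nat j = (1 :: 'a)" using of_nat_inverse_exists by blast
    have "x - of_nat k = (of_nat k * of_nat j) * x - of_nat k * (v + of_nat j * x)"
      using k vj(2) by simp
    also have "\<dots> = 0 - of_nat k * v" by (simp add: algebra_simps)
    also have "\<dots> \<in> V"
      using V(1) vj(1) by (intro add_subgroup_diff add_subgroup_of_nat_mult) (auto simp: add_subgroup_def)
    finally show ?thesis by blast
  qed
  define k where "k x = (SOME k. x - of_nat k \<in> V)" for x
  have k: "x - of_nat (k x) \<in> V" for x unfolding k_def using ex by (rule someI_ex)
  define \<zeta> where "\<zeta> = cis (2 * pi / ?p)"
  have p: "?p > 1" by (rule CHAR_gt_1_finite)
  have \<zeta>p: "\<zeta> ^ ?p = 1" using p by (simp add: \<zeta>_def DeMoivre)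
  \<comment> \<open>As p is at least 2, the angle lies in (0, pi], where the cosine is below 1;
    hence the root of unity is not 1.\<close>
  have "cos (2 * pi / ?p) < cos 0"
    using p by (intro cos_monotone_0_pi) (auto simp: field_simps)
  then have \<zeta>: "\<zeta> \<noteq> 1" by (auto simp: \<zeta>_def complex_eq_iff)
  have le: "\<zeta> ^ i = \<zeta> ^ j" if ij: "of_nat j - of_nat i \<in> V" "i \<le> j" for i j
  proof -
    have "of_nat (j - i) * 1 \<in> V" using ij by (simp add: of_nat_diff)
    then have "(of_nat (j - i) :: 'a) = 0" using add_subgroup_divide[OF V(1)] V(2) by blast
    then obtain t where "j = i + ?p * t"
      using ij(2) by (metis of_nat_eq_0_iff_char_dvd dvdE le_add_diff_inverse)
    then show ?thesis by (simp add: power_add power_mult \<zeta>p)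
  qed
  \<comment> \<open>Representatives congruent modulo V give the same power, so the arbitrary choice
    of \<open>k x\<close> does not matter and additivity follows.\<close>
  have eq: "\<zeta> ^ i = \<zeta> ^ j" if "(of_nat j :: 'a) - of_nat i \<in> V" for i j
  proof (cases "i \<le> j")
    case False
    have "of_nat i - of_nat j \<in> V"
      using add_subgroup_diff[OF V(1) _ that, of 0] V(1) by (simp add: add_subgroup_def)
    then show ?thesis using le[of i j] False by simp
  qed (use that le in blast)
  have "add_char (\<lambda>x. \<zeta> ^ k x)"
    unfolding add_char_def
  proof (intro conjI allI)
    fix x y
    have "(x - of_nat (k x)) + (y - of_nat (k y)) \<in> V"
      using V(1) k[of x] k[of y] unfolding add_subgroup_def by blast
    from add_subgroup_diff[OF V(1) this k[of "x + y"]]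
    have "of_nat (k (x + y)) - of_nat (k x + k y) \<in> V" by (simp add: algebra_simps)
    from eq[OF this] show "\<zeta> ^ k (x + y) = \<zeta> ^ k x * \<zeta> ^ k y" by (simp add: power_add)
  qed (simp add: \<zeta>_def norm_power)
  moreover have "\<zeta> ^ k 1 \<noteq> 1"
    using eq[of 1 "k 1"] k[of 1] \<zeta> by simp
  ultimately show ?thesis using that by blast
qed

subsection \<open>Finite extensions inside the algebraic closure\<close>

lemma freshmans_dream_ac:
  fixes x y :: "'a::{finite,field} alg_closure"
  shows "(x + y) ^ (CARD('a) ^ n) = x ^ (CARD('a) ^ n) + y ^ (CARD('a) ^ n)"
proof -
  obtain s where "CARD('a) = CHAR('a) ^ s" using CARD_eq_CHAR_power by blast
  then have "CARD('a) ^ n = CHAR('a alg_closure) ^ (s * n)" by (simp add: power_mult)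
  moreover have "prime (CHAR('a alg_closure))" by (simp add: prime_CHAR_finite)
  ultimately show ?thesis by (metis freshmans_dream')
qed

lemma freshmans_dream_ac_sum:
  fixes h :: "'i \<Rightarrow> 'a::{finite,field} alg_closure"
  shows "(\<Sum>i\<in>I. h i) ^ (CARD('a) ^ n) = (\<Sum>i\<in>I. h i ^ (CARD('a) ^ n))"
  by (induction I rule: infinite_finite_induct) (simp_all add: freshmans_dream_ac power_0_left)

lemma freshmans_dream_ac_diff:
  fixes x y :: "'a::{finite,field} alg_closure"
  shows "(x - y) ^ (CARD('a) ^ n) = x ^ (CARD('a) ^ n) - y ^ (CARD('a) ^ n)"
  using freshmans_dream_ac[of "x - y" y n] by (simp add: algebra_simps)

lemma frobenius_ac_inj:
  fixes x y :: "'a::{finite,field} alg_closure"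
  shows "x ^ (CARD('a) ^ n) = y ^ (CARD('a) ^ n) \<longleftrightarrow> x = y"
  using freshmans_dream_ac_diff[of x y n] by auto

section \<open>Polynomials transferred to the algebraic closure\<close>

lemma map_poly_mult_hom:
  fixes h :: "'b::comm_semiring_1 \<Rightarrow> 'c::comm_semiring_1"
  assumes "h 0 = 0" "\<And>x y. h (x + y) = h x + h y" "\<And>x y. h (x * y) = h x * h y"
  shows "map_poly h (p * q) = map_poly h p * map_poly h q"
proof (rule poly_eqI)
  have "h (\<Sum>i\<in>I. u i) = (\<Sum>i\<in>I. h (u i))" for I :: "nat set" and u
    by (induction I rule: infinite_finite_induct) (simp_all add: assms)
  then show "coeff (map_poly h (p * q)) n = coeff (map_poly h p * map_poly h q) n" for n
    by (simp add: coeff_map_poly coeff_mult assms)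
qed

lemma map_poly_prod_hom:
  fixes h :: "'b::comm_semiring_1 \<Rightarrow> 'c::comm_semiring_1"
  assumes "h 0 = 0" "h 1 = 1" "\<And>x y. h (x + y) = h x + h y" "\<And>x y. h (x * y) = h x * h y"
  shows "map_poly h (\<Prod>i\<in>I. p i) = (\<Prod>i\<in>I. map_poly h (p i))"
  by (induction I rule: infinite_finite_induct) (simp_all add: assms map_poly_mult_hom)

abbreviation ac_poly :: "'a::field poly \<Rightarrow> 'a alg_closure poly" where
  "ac_poly \<equiv> map_poly to_ac"

lemma ac_poly_mult: "ac_poly (p * q) = ac_poly p * ac_poly q"
  by (rule map_poly_mult_hom) simp_all

lemma ac_poly_add: "ac_poly (p + q) = ac_poly p + ac_poly q"
  by (rule poly_eqI) (simp add: coeff_map_poly)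

lemma ac_poly_power: "ac_poly (p ^ n) = ac_poly p ^ n"
  by (induction n) (simp_all add: ac_poly_mult)

lemma ac_poly_sum: "ac_poly (\<Sum>i\<in>I. p i) = (\<Sum>i\<in>I. ac_poly (p i))"
  by (induction I rule: infinite_finite_induct) (simp_all add: ac_poly_add)

lemma degree_ac_poly [simp]: "degree (ac_poly p) = degree p"
  by (rule degree_map_poly) simp

lemma ac_poly_eq_0_iff [simp]: "ac_poly p = 0 \<longleftrightarrow> p = 0"
  by (auto simp: poly_eq_iff coeff_map_poly)

lemma poly_ac_poly_to_ac [simp]: "poly (ac_poly p) (to_ac x) = to_ac (poly p x)"
  by (simp add: poly_altdef coeff_map_poly to_ac_sum)

lemma poly_ac_poly_frobenius:
  fixes p :: "'a::{finite,field} poly"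
  shows "poly (ac_poly p) (x ^ (CARD('a) ^ n)) = poly (ac_poly p) x ^ (CARD('a) ^ n)"
proof -
  have "to_ac c ^ (CARD('a) ^ n) = to_ac c" for c :: 'a
    by (metis to_ac_power power_CARD_power_eq_self)
  then show ?thesis
    by (simp add: poly_altdef coeff_map_poly freshmans_dream_ac_sum power_mult_distrib
      flip: power_mult) (simp add: mult.commute)
qed

text \<open>For n > 0 this is the subfield with q^n elements, as the fixed points of a Frobenius
  power. For n = 0 it is the whole closure, whence the positivity hypotheses below.\<close>

definition fixed_field :: "nat \<Rightarrow> 'a::{finite,field} alg_closure set" where
  "fixed_field n = {x. x ^ (CARD('a) ^ n) = x}"

lemma CARD_field_ge_2: "CARD('a::{finite,field}) \<ge> 2"
  using card_mono[of UNIV "{0, 1 :: 'a}"] by simp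

lemma sum_order_alg_closed:
  fixes p :: "'b::alg_closed_field poly"
  assumes "p \<noteq> 0"
  shows "(\<Sum>x | poly p x = 0. order x p) = degree p"
proof -
  obtain A where A: "size A = degree p" "p = smult (lead_coeff p) (\<Prod>x\<in>#A. [:-x, 1:])"
    using alg_closed_imp_factorization[OF assms] by blast
  have "proots (\<Prod>x\<in>#A. [:-x, 1:]) = A"
  proof (induction A)
    case (add x A)
    have "(\<Prod>x\<in>#A. [:-x, 1:]) \<noteq> 0" by (auto simp: prod_mset_zero_iff)
    then show ?case using add by (simp add: proots_mult del: mult_pCons_left)
  qed simp
  then have "proots p = A"
    using assms by (subst A(2)) simp
  then have "size (proots p) = degree p" using A(1) by simp
  then show ?thesis using assms by (simp add: size_multiset_overloaded_eq)
qed

lemma fixed_field_eq_roots: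
  "fixed_field n = {x :: 'a::{finite,field} alg_closure. poly (monom 1 (CARD('a) ^ n) - monom 1 1) x = 0}"
  by (auto simp: fixed_field_def poly_monom)

lemma degree_frobenius_poly:
  assumes "n > 0"
  shows "degree (monom 1 (CARD('a::{finite,field}) ^ n) - monom 1 1 :: 'b::field poly) = CARD('a) ^ n"
proof -
  have "1 < CARD('a) ^ n" using CARD_field_ge_2[where 'a='a] assms by (intro one_less_power) simp_all
  then show ?thesis
    unfolding diff_conv_add_uminus by (subst degree_add_eq_left) (simp_all add: degree_monom_eq)
qed

text \<open>The derivative of X^(q^n) - X is -1, so all its roots are simple and their number equals
  the degree.\<close>

lemma card_fixed_field:
  assumes "n > 0"
  shows "card (fixed_field n :: 'a::{finite,field} alg_closure set) = CARD('a) ^ n"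
proof -
  let ?P = "monom 1 (CARD('a) ^ n) - monom 1 1 :: 'a alg_closure poly"
  have deg: "degree ?P = CARD('a) ^ n" using assms by (rule degree_frobenius_poly)
  then have nz: "?P \<noteq> 0" by (metis degree_0 zero_less_card_finite zero_less_power less_irrefl)
  have "(of_nat (CARD('a)) :: 'a alg_closure) = 0"
  proof -
    obtain s where s: "CARD('a) = CHAR('a) ^ s" using CARD_eq_CHAR_power by blast
    with CARD_field_ge_2[where 'a='a] have "s \<noteq> 0" by (cases s) simp_all
    then show ?thesis by (simp add: s flip: to_ac_of_nat)
  qed
  then have deriv: "pderiv ?P = - 1"
    using assms by (simp add: pderiv_diff pderiv_monom flip: monom_0 one_pCons)
  have "order x ?P = 1" if "poly ?P x = 0" for x
  proof (rule ccontr)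
    assume "order x ?P \<noteq> 1"
    moreover have "order x ?P \<noteq> 0" using that nz order_root[of ?P x] by blast
    ultimately have "[:-x, 1:] ^ 2 dvd ?P" by (intro order_divides[THEN iffD2]) simp
    then obtain h where "?P = [:-x, 1:] ^ 2 * h" by (elim dvdE)
    then have "pderiv ?P = [:-x, 1:] * pderiv ([:-x, 1:] * h) + ([:-x, 1:] * h) * pderiv [:-x, 1:]"
      by (simp only: power2_eq_square mult.assoc pderiv_mult)
    then have "poly (pderiv ?P) x = 0" by (simp only: poly_add poly_mult) simp
    then show False unfolding deriv by simp
  qed
  then have "(\<Sum>x | poly ?P x = 0. order x ?P) = card {x. poly ?P x = 0}" by simp
  then show ?thesis
    unfolding fixed_field_eq_roots sum_order_alg_closed[OF nz] deg by simp
qed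

lemma finite_fixed_field: "n > 0 \<Longrightarrow> finite (fixed_field n :: 'a::{finite,field} alg_closure set)"
  using card_fixed_field[of n, where 'a='a] by (intro card_ge_0_finite) simp

lemma fixed_field_1: "fixed_field 1 = range (to_ac :: 'a::{finite,field} \<Rightarrow> _)"
proof (rule card_subset_eq[symmetric])
  show "finite (fixed_field 1 :: 'a alg_closure set)" by (simp add: finite_fixed_field)
  show "range (to_ac :: 'a \<Rightarrow> _) \<subseteq> fixed_field 1"
    by (auto simp: fixed_field_def power_CARD_eq_self simp flip: to_ac_power)
  show "card (range (to_ac :: 'a \<Rightarrow> _)) = card (fixed_field 1 :: 'a alg_closure set)"
    using card_fixed_field[of 1, where 'a='a] by (simp add: card_image inj_to_ac)
qed

lemma to_ac_of_ac_fixed: "x ^ CARD('a) = x \<Longrightarrow> to_ac (of_ac x) = (x :: 'a::{finite,field} alg_closure)"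
  using fixed_field_1[where 'a='a] by (intro to_ac_of_ac) (auto simp: fixed_field_def)

text \<open>On \<open>fixed_field n\<close> this is the trace down to the field with q elements, as
  the sum of the Frobenius conjugates.\<close>

definition ac_trace :: "nat \<Rightarrow> 'a::{finite,field} alg_closure \<Rightarrow> 'a alg_closure" where
  "ac_trace n x = (\<Sum>t<n. x ^ (CARD('a) ^ t))"

lemma ac_trace_fixed:
  fixes x :: "'a::{finite,field} alg_closure"
  assumes "x \<in> fixed_field n"
  shows "ac_trace n x ^ CARD('a) = ac_trace n x"
proof -
  have "ac_trace n x ^ CARD('a) = (\<Sum>t<n. x ^ (CARD('a) ^ Suc t))"
    using freshmans_dream_ac_sum[of "\<lambda>t. x ^ (CARD('a) ^ t)" "{..<n}" 1]
    by (simp add: ac_trace_def mult.commute flip: power_mult)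
  also have "\<dots> = ac_trace n x"
    unfolding ac_trace_def using sum.lessThan_Suc_shift[of "\<lambda>t. x ^ (CARD('a) ^ t)" n] assms
    by (simp add: fixed_field_def)
  finally show ?thesis .
qed

lemma fixed_field_poly: "x \<in> fixed_field n \<Longrightarrow> poly (ac_poly p) x \<in> fixed_field n"
  by (simp add: fixed_field_def flip: poly_ac_poly_frobenius)

lemma power_frobenius_add:
  fixes x :: "'a::{finite,field} alg_closure"
  shows "x ^ (CARD('a) ^ (i + j)) = (x ^ (CARD('a) ^ i)) ^ (CARD('a) ^ j)"
  by (simp add: power_add flip: power_mult)

section \<open>Frobenius orbits and minimal polynomials\<close>

definition orbit_size :: "'a::{finite,field} alg_closure \<Rightarrow> nat" where
  "orbit_size x = (LEAST e. 0 < e \<and> x \<in> fixed_field e)"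

text \<open>The minimal polynomial of x over the base field. The use of \<open>of_ac\<close> is
  justified by \<open>ac_orbit_poly\<close>, which shows that the coefficients of the product
  descend.\<close>

definition orbit_poly :: "'a::{finite,field} alg_closure \<Rightarrow> 'a poly" where
  "orbit_poly x = map_poly of_ac (\<Prod>i<orbit_size x. [:- (x ^ (CARD('a) ^ i)), 1:])"

lemma fixed_field_mult:
  assumes "x \<in> fixed_field e"
  shows "x \<in> fixed_field (e * n)"
proof (induction n)
  case (Suc n)
  then show ?case using assms power_frobenius_add[of x e "e * n"] by (simp add: fixed_field_def)
qed (simp add: fixed_field_def)

context
  fixes x :: "'a::{finite,field} alg_closure" and n :: nat
  assumes x: "x \<in> fixed_field n" and n: "0 < n"
begin

lemma orbit_size_pos: "0 < orbit_size x"
  and fixed_field_orbit_size: "x \<in> fixed_field (orbit_size x)"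
  and orbit_size_le: "orbit_size x \<le> n"
proof -
  have "0 < orbit_size x \<and> x \<in> fixed_field (orbit_size x)"
    unfolding orbit_size_def by (rule LeastI[of _ n]) (use x n in simp)
  then show "0 < orbit_size x" "x \<in> fixed_field (orbit_size x)" by simp_all
  show "orbit_size x \<le> n" unfolding orbit_size_def by (rule Least_le) (use x n in simp)
qed

text \<open>Division with remainder: the remainder of m modulo the orbit size also fixes x, so
  minimality forces it to be 0.\<close>

lemma fixed_field_iff_dvd: "x \<in> fixed_field m \<longleftrightarrow> orbit_size x dvd m"
proof
  assume m: "x \<in> fixed_field m"
  let ?e = "orbit_size x"
  have "x \<in> fixed_field (m mod ?e)"
  proof -
    have "x ^ (CARD('a) ^ (?e * (m div ?e) + m mod ?e)) = x" using m by (simp add: fixed_field_def)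
    then show ?thesis
      unfolding power_frobenius_add using fixed_field_mult[OF fixed_field_orbit_size, of "m div ?e"]
      by (simp add: fixed_field_def)
  qed
  then have "m mod ?e = 0"
    using not_less_Least[of "m mod ?e" "\<lambda>e. 0 < e \<and> x \<in> fixed_field e"] orbit_size_pos
    by (auto simp: orbit_size_def[symmetric])
  then show "?e dvd m" by auto
next
  assume "orbit_size x dvd m"
  then show "x \<in> fixed_field m" using fixed_field_mult[OF fixed_field_orbit_size] by (elim dvdE) simp
qed

lemma orbit_inj: "inj_on (\<lambda>i. x ^ (CARD('a) ^ i)) {..<orbit_size x}"
proof -
  have less: False if "i < j" "j < orbit_size x" "x ^ (CARD('a) ^ i) = x ^ (CARD('a) ^ j)" for i j
  proof -
    have "x ^ (CARD('a) ^ i) = (x ^ (CARD('a) ^ (j - i))) ^ (CARD('a) ^ i)"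
      using that by (simp flip: power_frobenius_add)
    then have "x \<in> fixed_field (j - i)" by (simp add: frobenius_ac_inj fixed_field_def)
    then have "orbit_size x dvd j - i" by (simp add: fixed_field_iff_dvd)
    then show False using that by (auto dest: dvd_imp_le)
  qed
  show ?thesis
  proof (rule inj_onI)
    fix i j assume "i \<in> {..<orbit_size x}" "j \<in> {..<orbit_size x}" "x ^ (CARD('a) ^ i) = x ^ (CARD('a) ^ j)"
    then show "i = j" using less[of i j] less[of j i] by (cases i j rule: linorder_cases) simp_all
  qed
qed

text \<open>Raising coefficients to the q-th power permutes the linear factors cyclically. The
  coefficients are therefore Frobenius-invariant and come from the base field.\<close>

lemma ac_orbit_poly: "ac_poly (orbit_poly x) = (\<Prod>i<orbit_size x. [:- (x ^ (CARD('a) ^ i)), 1:])" (is "_ = ?M")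
proof -
  let ?e = "orbit_size x"
  let ?c = "\<lambda>i. x ^ (CARD('a) ^ i)"
  have fr: "(y + z) ^ CARD('a) = y ^ CARD('a) + z ^ CARD('a)" "(y - z) ^ CARD('a) = y ^ CARD('a) - z ^ CARD('a)"
    for y z :: "'a alg_closure"
    using freshmans_dream_ac[of y z 1] freshmans_dream_ac_diff[of y z 1] by simp_all
  have neg: "(- y) ^ CARD('a) = - (y ^ CARD('a))" for y :: "'a alg_closure"
    using fr(2)[of 0 y] by simp
  have "map_poly (\<lambda>y. y ^ CARD('a)) ?M = (\<Prod>i<?e. map_poly (\<lambda>y. y ^ CARD('a)) [:- ?c i, 1:])"
    by (rule map_poly_prod_hom) (simp_all add: fr power_mult_distrib)
  also have "\<dots> = (\<Prod>i<?e. [:- ?c (Suc i), 1:])"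
    by (simp add: map_poly_pCons neg mult.commute flip: power_mult)
  also have "\<dots> = ?M"
  proof -
    obtain k where k: "?e = Suc k" using orbit_size_pos by (cases ?e) simp_all
    have "?c (Suc k) = x" using fixed_field_orbit_size k by (simp add: fixed_field_def)
    then show ?thesis
      unfolding k using prod.lessThan_Suc_shift[of "\<lambda>i. [:- ?c i, 1:]" k]
      by (simp add: mult.commute del: mult_pCons_left mult_pCons_right power_Suc)
  qed
  finally have "coeff ?M j ^ CARD('a) = coeff ?M j" for j
    by (metis (no_types, lifting) coeff_map_poly power_0_left zero_less_card_finite less_irrefl)
  then show ?thesis
    by (intro poly_eqI) (simp add: orbit_poly_def coeff_map_poly to_ac_of_ac_fixed)
qed

lemma lead_coeff_orbit_poly: "lead_coeff (orbit_poly x) = 1"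
  and degree_orbit_poly: "degree (orbit_poly x) = orbit_size x"
proof -
  have "lead_coeff (ac_poly (orbit_poly x)) = 1"
    unfolding ac_orbit_poly lead_coeff_prod by simp
  then have "to_ac (lead_coeff (orbit_poly x)) = to_ac 1" by (simp add: coeff_map_poly)
  then show "lead_coeff (orbit_poly x) = 1" by (simp only: to_ac_eq_iff)
  have "degree (ac_poly (orbit_poly x)) = orbit_size x"
    unfolding ac_orbit_poly by (subst degree_prod_eq_sum_degree) auto
  then show "degree (orbit_poly x) = orbit_size x" by simp
qed

lemma orbit_poly_nonzero: "orbit_poly x \<noteq> 0"
  using lead_coeff_orbit_poly by auto

text \<open>If g vanishes at x, so does its remainder modulo \<open>orbit_poly x\<close>, and with x
  all its conjugates. That is more roots than the degree of a nonzero remainder allows.\<close>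

lemma orbit_poly_dvd_iff: "orbit_poly x dvd g \<longleftrightarrow> poly (ac_poly g) x = 0"
proof
  have "poly (ac_poly (orbit_poly x)) x = 0"
    unfolding ac_orbit_poly using orbit_size_pos by (auto simp: poly_prod intro!: bexI[of _ 0])
  then show "orbit_poly x dvd g \<Longrightarrow> poly (ac_poly g) x = 0"
    by (elim dvdE) (simp add: ac_poly_mult)
next
  assume g: "poly (ac_poly g) x = 0"
  define r where "r = g mod orbit_poly x"
  have "g = orbit_poly x * (g div orbit_poly x) + r" by (simp add: r_def)
  then have "poly (ac_poly g) x = poly (ac_poly (orbit_poly x)) x * poly (ac_poly (g div orbit_poly x)) x + poly (ac_poly r) x"
    by (metis ac_poly_add ac_poly_mult poly_add poly_mult)
  moreover have "poly (ac_poly (orbit_poly x)) x = 0"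
    unfolding ac_orbit_poly using orbit_size_pos by (auto simp: poly_prod intro!: bexI[of _ 0])
  ultimately have rx: "poly (ac_poly r) x = 0" using g by simp
  have "r = 0"
  proof (rule ccontr)
    assume "r \<noteq> 0"
    have "(\<lambda>i. x ^ (CARD('a) ^ i)) ` {..<orbit_size x} \<subseteq> {y. poly (ac_poly r) y = 0}"
      using rx by (auto simp: poly_ac_poly_frobenius power_0_left)
    then have "orbit_size x \<le> card {y. poly (ac_poly r) y = 0}"
      using card_mono[OF poly_roots_finite] card_image[OF orbit_inj] \<open>r \<noteq> 0\<close>
      by (metis ac_poly_eq_0_iff card_lessThan)
    also have "\<dots> \<le> degree (ac_poly r)" using \<open>r \<noteq> 0\<close> by (intro card_poly_roots_bound) simp
    also have "\<dots> < orbit_size x"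
      using degree_mod_less'[of "orbit_poly x" g] \<open>r \<noteq> 0\<close> orbit_poly_nonzero by (simp add: r_def degree_orbit_poly)
    finally show False by simp
  qed
  then show "orbit_poly x dvd g" by (simp add: r_def mod_eq_0_iff_dvd)
qed

lemma order_orbit_poly: "order x (ac_poly (orbit_poly x)) = 1"
proof -
  let ?c = "\<lambda>i. x ^ (CARD('a) ^ i)"
  obtain k where k: "orbit_size x = Suc k" using orbit_size_pos by (cases "orbit_size x") simp_all
  let ?Q = "\<Prod>i<k. [:- ?c (Suc i), 1:]"
  have M: "ac_poly (orbit_poly x) = [:- x, 1:] * ?Q"
    unfolding ac_orbit_poly k prod.lessThan_Suc_shift by (simp del: mult_pCons_left power_Suc)
  have "poly ?Q x \<noteq> 0"
  proof
    assume "poly ?Q x = 0"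
    then obtain i where "i < k" "?c (Suc i) = ?c 0" by (auto simp: poly_prod)
    then have "Suc i = 0" using orbit_inj by (intro inj_onD[OF orbit_inj]) (simp_all add: k)
    then show False by simp
  qed
  then have "order x ?Q = 0" by (rule order_0I)
  moreover have "ac_poly (orbit_poly x) \<noteq> 0" by (simp add: orbit_poly_nonzero)
  ultimately show ?thesis
    unfolding M by (subst order_mult) (use order_power_n_n[of x 1] in \<open>simp_all del: mult_pCons_left\<close>)
qed

text \<open>Since x is a simple root of its minimal polynomial, splitting off one copy lowers the
  multiplicity of x by exactly 1.\<close>

lemma orbit_poly_power_dvd_iff: "g \<noteq> 0 \<Longrightarrow> orbit_poly x ^ j dvd g \<longleftrightarrow> j \<le> order x (ac_poly g)"
proof (induction j arbitrary: g)
  case (Suc j)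
  show ?case
  proof (cases "orbit_poly x dvd g")
    case True
    then obtain h where h: "g = orbit_poly x * h" by (elim dvdE)
    with Suc.prems have "h \<noteq> 0" by auto
    have "order x (ac_poly g) = 1 + order x (ac_poly h)"
      unfolding h ac_poly_mult using \<open>h \<noteq> 0\<close> orbit_poly_nonzero order_orbit_poly
      by (subst order_mult) simp_all
    moreover have "orbit_poly x ^ Suc j dvd g \<longleftrightarrow> orbit_poly x ^ j dvd h"
      unfolding h power_Suc using orbit_poly_nonzero by (rule dvd_times_left_cancel_iff)
    ultimately show ?thesis using Suc.IH[OF \<open>h \<noteq> 0\<close>] by simp
  next
    case False
    then have "\<not> orbit_poly x ^ Suc j dvd g" by (metis dvd_mult_left power_Suc)
    moreover have "order x (ac_poly g) = 0"
      using False by (intro order_0I) (simp add: orbit_poly_dvd_iff)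
    ultimately show ?thesis by simp
  qed
qed simp

end

subsection \<open>The L-function of a character sum\<close>

lemma card_poly_degree_le:
  "finite {p :: 'a::{finite,field} poly. degree p \<le> n}"
  "card {p :: 'a::{finite,field} poly. degree p \<le> n} \<le> CARD('a) ^ Suc n"
proof -
  let ?r = "\<lambda>p :: 'a poly. restrict (coeff p) {..n}" and ?A = "{p :: 'a poly. degree p \<le> n}"
  have inj: "inj_on ?r ?A"
  proof (rule inj_onI)
    fix p q assume "p \<in> ?A" "q \<in> ?A" and eq: "?r p = ?r q"
    have "coeff p i = coeff q i" for i
    proof (cases "i \<le> n")
      case True
      then show ?thesis using fun_cong[OF eq, of i] by simp
    next
      case False
      then show ?thesis using \<open>p \<in> ?A\<close> \<open>q \<in> ?A\<close> by (simp add: coeff_eq_0)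
    qed
    then show "p = q" by (simp add: poly_eq_iff)
  qed
  have sub: "?r ` ?A \<subseteq> (\<Pi>\<^sub>E i\<in>{..n}. UNIV)" by (intro image_subsetI) (simp add: restrict_PiE_iff)
  have fin: "finite (\<Pi>\<^sub>E i\<in>{..n}. UNIV :: 'a set)" by (intro finite_PiE) simp_all
  show "finite ?A" using inj_on_finite[OF inj sub fin] .
  show "card ?A \<le> CARD('a) ^ Suc n" using card_inj_on_le[OF inj sub fin] by (simp add: card_PiE)
qed

text \<open>The sum of \<open>f\<close> over the roots of \<open>g\<close> in the algebraic closure, with multiplicity.\<close>
definition root_trace :: "'a::field poly \<Rightarrow> 'a poly \<Rightarrow> 'a" where
  "root_trace f g = (\<Sum>j\<le>degree f. coeff f j * power_sums g $ j)"

lemma root_trace_mult: "g \<noteq> 0 \<Longrightarrow> h \<noteq> 0 \<Longrightarrow> root_trace f (g * h) = root_trace f g + root_trace f h"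
  by (simp add: root_trace_def power_sums_mult distrib_left sum.distrib)

lemma root_trace_power: "g \<noteq> 0 \<Longrightarrow> root_trace f (g ^ n) = of_nat n * root_trace f g"
  by (induction n) (simp_all add: root_trace_mult algebra_simps, simp add: root_trace_def)

definition monics :: "nat \<Rightarrow> 'a::field poly set" where
  "monics n = {g. degree g = n \<and> lead_coeff g = 1}"

lemma finite_monics: "finite (monics n :: 'a::{finite,field} poly set)"
  by (rule finite_subset[OF _ card_poly_degree_le(1)[of n]]) (auto simp: monics_def)

text \<open>The coefficient of t^n in the L-function of the map sending g to
  \<open>\<psi> (root_trace f g)\<close>, which is multiplicative when \<open>\<psi>\<close> is an
  additive character.\<close>

definition L_coeff :: "('a::{finite,field} \<Rightarrow> complex) \<Rightarrow> 'a poly \<Rightarrow> nat \<Rightarrow> complex" where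
  "L_coeff \<psi> f n = (\<Sum>g\<in>monics n. \<psi> (root_trace f g))"

definition ext_sum :: "('a::{finite,field} \<Rightarrow> complex) \<Rightarrow> 'a poly \<Rightarrow> nat \<Rightarrow> complex" where
  "ext_sum \<psi> f n = (\<Sum>x\<in>fixed_field n. \<psi> (of_ac (ac_trace n (poly (ac_poly f) x))))"

lemma L_coeff_0:
  assumes "add_char \<psi>"
  shows "L_coeff \<psi> f 0 = 1"
proof -
  have "monics 0 = {1 :: 'a poly}" by (auto simp: monics_def elim!: degree_eq_zeroE)
  then show ?thesis using assms by (simp add: L_coeff_def root_trace_def add_char_0)
qed

text \<open>
  Adding \<open>e X^(n - d)\<close> to \<open>g\<close> changes only the \<open>d\<close>-th among the first \<open>d\<close> power sums, so it shifts
  \<open>root_trace f g\<close> by a nonzero multiple of \<open>e\<close>.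
\<close>
lemma L_coeff_eq_0:
  fixes \<psi> :: "'a::{finite,field} \<Rightarrow> complex"
  assumes "add_char \<psi>" "\<psi> z \<noteq> 1" "(of_nat (degree f) :: 'a) \<noteq> 0" "degree f \<le> n"
  shows "L_coeff \<psi> f n = 0"
proof -
  let ?d = "degree f"
  define c where "c = coeff f ?d * of_nat ?d"
  have "?d > 0" using assms(3) by (cases ?d) simp_all
  have "c \<noteq> 0" using assms(3) \<open>?d > 0\<close> by (auto simp: c_def)
  define e where "e = - z / c"
  let ?s = "\<lambda>e g. g + monom e (n - ?d)"
  have shift: "root_trace f (?s e g) = root_trace f g - c * e" if "g \<in> monics n" for g and e :: 'a
  proof -
    have g: "lead_coeff g = 1" "0 < ?d" "?d \<le> degree g" "degree g = n"
      using that assms(4) \<open>?d > 0\<close> by (auto simp: monics_def)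
    have *: "power_sums (?s e g) $ j = power_sums g $ j - (if j = ?d then of_nat ?d * e else 0)" if "j \<le> ?d" for j
      using power_sums_perturb(3,4)[OF g(1-3)] that g(4) by auto
    have "root_trace f (?s e g)
        = (\<Sum>j\<le>?d. coeff f j * power_sums g $ j - (if j = ?d then coeff f ?d * (of_nat ?d * e) else 0))"
      unfolding root_trace_def by (intro sum.cong refl) (simp add: * right_diff_distrib)
    then show ?thesis by (simp add: root_trace_def sum_subtractf c_def mult.assoc)
  qed
  have mem: "?s e g \<in> monics n" if "g \<in> monics n" for g and e :: 'a
  proof -
    have g: "lead_coeff g = 1" "degree g = n" using that by (auto simp: monics_def)
    then show ?thesis
      using power_sums_perturb(1,2)[OF g(1) \<open>?d > 0\<close>, of e] assms(4) unfolding monics_def mem_Collect_eq by simp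
  qed
  have "L_coeff \<psi> f n = (\<Sum>g\<in>monics n. \<psi> (root_trace f (?s e g)))"
    unfolding L_coeff_def
    by (rule sum.reindex_bij_witness[of _ "?s e" "?s (- e)"]) (simp_all add: mem add.assoc add_monom)
  also have "\<dots> = (\<Sum>g\<in>monics n. \<psi> z * \<psi> (root_trace f g))"
    using \<open>c \<noteq> 0\<close> by (intro sum.cong) (simp_all add: shift e_def add.commute flip: add_char_add[OF assms(1)])
  also have "\<dots> = \<psi> z * L_coeff \<psi> f n" by (simp add: L_coeff_def sum_distrib_left)
  finally show ?thesis using assms(2) by simp
qed

text \<open>Multiplication by m matches monic cofactors of degree n - deg m with monic multiples of
  degree n, and \<open>root_trace\<close> is additive on products.\<close>

lemma sum_monics_dvd:
  fixes \<psi> :: "'a::{finite,field} \<Rightarrow> complex"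
  assumes "add_char \<psi>" "lead_coeff m = 1"
  shows "(\<Sum>g | g \<in> monics n \<and> m dvd g. \<psi> (root_trace f g))
    = (if degree m \<le> n then \<psi> (root_trace f m) * L_coeff \<psi> f (n - degree m) else 0)"
proof -
  have nz: "m \<noteq> 0" using assms(2) by auto
  have *: "degree (m * h) = degree m + degree h" if "lead_coeff h = 1" for h :: "'a poly"
  proof -
    have "h \<noteq> 0" using that by auto
    with nz show ?thesis by (rule degree_mult_eq)
  qed
  show ?thesis
  proof (cases "degree m \<le> n")
    case True
    have "(\<Sum>g | g \<in> monics n \<and> m dvd g. \<psi> (root_trace f g))
        = (\<Sum>h\<in>monics (n - degree m). \<psi> (root_trace f (m * h)))"
    proof (rule sum.reindex_bij_witness[of _ "\<lambda>h. m * h" "\<lambda>g. g div m"])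
      fix g assume g: "g \<in> {g. g \<in> monics n \<and> m dvd g}"
      then show "m * (g div m) = g" by simp
      have "lead_coeff (m * (g div m)) = 1" "degree (m * (g div m)) = n"
        using g by (auto simp: monics_def)
      moreover from this(1) assms(2) have "lead_coeff (g div m) = 1" by (simp add: lead_coeff_mult)
      ultimately show "g div m \<in> monics (n - degree m)" using * by (simp add: monics_def)
    next
      fix h :: "'a poly" assume h: "h \<in> monics (n - degree m)"
      show "m * h div m = h" using nz by simp
      have "lead_coeff h = 1" "degree h = n - degree m" using h by (auto simp: monics_def)
      then have "degree (m * h) = n" "lead_coeff (m * h) = 1"
        using *[of h] True assms(2) lead_coeff_mult[of m h] by simp_all
      then show "m * h \<in> {g. g \<in> monics n \<and> m dvd g}" by (simp only: monics_def mem_Collect_eq dvd_triv_left simp_thms)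
    qed simp
    also have "\<dots> = (\<Sum>h\<in>monics (n - degree m). \<psi> (root_trace f m) * \<psi> (root_trace f h))"
      by (intro sum.cong refl, subst root_trace_mult)
        (use nz in \<open>auto simp: monics_def add_char_add[OF assms(1)]\<close>)
    finally show ?thesis using True by (simp add: L_coeff_def sum_distrib_left)
  next
    case False
    have "\<not> m dvd g" if "g \<in> monics n" for g
    proof -
      have "g \<noteq> 0" "degree g = n" using that by (auto simp: monics_def)
      then show ?thesis using dvd_imp_degree_le[of m g] False by auto
    qed
    then have "{g. g \<in> monics n \<and> m dvd g} = {}" by blast
    then show ?thesis using False by (simp only: sum.empty if_False)
  qed
qed

text \<open>The root trace of the minimal polynomial sums f over one orbit of x. The trace from the
  extension of degree j times the orbit size runs through that orbit j times.\<close>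

lemma ac_trace_orbit:
  fixes f :: "'a::{finite,field} poly"
  assumes "x \<in> fixed_field n" "0 < n"
  shows "ac_trace (j * orbit_size x) (poly (ac_poly f) x) = to_ac (of_nat j * root_trace f (orbit_poly x))"
proof -
  let ?e = "orbit_size x" and ?y = "poly (ac_poly f) x"
  note nz = orbit_poly_nonzero[OF assms]
  have ps: "power_sums (ac_poly (orbit_poly x)) $ k = (\<Sum>t<?e. (x ^ (CARD('a) ^ t)) ^ k)" for k
    using power_sums_split[of "image_mset (\<lambda>t. x ^ (CARD('a) ^ t)) (mset_set {..<?e})" k]
    unfolding ac_orbit_poly[OF assms]
    by (simp add: image_mset.compositionality comp_def flip: prod_unfold_prod_mset sum_unfold_sum_mset)
  have "to_ac (root_trace f (orbit_poly x)) = (\<Sum>k\<le>degree f. to_ac (coeff f k) * (\<Sum>t<?e. (x ^ (CARD('a) ^ t)) ^ k))"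
    by (simp add: root_trace_def to_ac_sum ps flip: power_sums_map_to_ac[OF nz])
  also have "\<dots> = (\<Sum>t<?e. poly (ac_poly f) (x ^ (CARD('a) ^ t)))"
    unfolding poly_altdef sum_distrib_left by (subst sum.swap) (simp add: coeff_map_poly)
  also have "\<dots> = (\<Sum>t<?e. ?y ^ (CARD('a) ^ t))" by (simp add: poly_ac_poly_frobenius)
  finally have tr: "to_ac (root_trace f (orbit_poly x)) = (\<Sum>t<?e. ?y ^ (CARD('a) ^ t))" .
  have "?y \<in> fixed_field ?e" using fixed_field_orbit_size[OF assms] by (rule fixed_field_poly)
  then have per: "?y ^ (CARD('a) ^ (m * ?e + t)) = ?y ^ (CARD('a) ^ t)" for m t
    using fixed_field_mult[of ?y ?e m] unfolding power_frobenius_add by (simp add: fixed_field_def mult.commute)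
  have "ac_trace (j * ?e) ?y = (\<Sum>m<j. \<Sum>t\<in>{m * ?e..<m * ?e + ?e}. ?y ^ (CARD('a) ^ t))"
    unfolding ac_trace_def by (rule sum.nat_group[symmetric])
  also have "\<dots> = (\<Sum>m<j. \<Sum>t<?e. ?y ^ (CARD('a) ^ (m * ?e + t)))"
  proof (rule sum.cong[OF refl])
    fix m
    show "(\<Sum>t\<in>{m * ?e..<m * ?e + ?e}. ?y ^ (CARD('a) ^ t)) = (\<Sum>t<?e. ?y ^ (CARD('a) ^ (m * ?e + t)))"
      using sum.shift_bounds_nat_ivl[of "\<lambda>t. ?y ^ (CARD('a) ^ t)" 0 "m * ?e" ?e]
      by (simp add: add.commute atLeast0LessThan)
  qed
  also have "\<dots> = of_nat j * (\<Sum>t<?e. ?y ^ (CARD('a) ^ t))" by (simp add: per)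
  finally show ?thesis by (simp add: tr)
qed

text \<open>The first deg g + 1 Frobenius conjugates of x are all roots of g, so two coincide, and
  injectivity of Frobenius cancels the common power.\<close>

lemma root_in_fixed_field:
  fixes g :: "'a::{finite,field} poly"
  assumes "g \<noteq> 0" "poly (ac_poly g) x = 0"
  obtains i where "0 < i" "i \<le> degree g" "x \<in> fixed_field i"
proof -
  let ?c = "\<lambda>i. x ^ (CARD('a) ^ i)" and ?R = "{y. poly (ac_poly g) y = 0}"
  have fin: "finite ?R" using assms(1) by (intro poly_roots_finite) simp
  have sub: "?c ` {..degree g} \<subseteq> ?R" using assms(2) by (auto simp: poly_ac_poly_frobenius power_0_left)
  have "card ?R \<le> degree g"
    using card_poly_roots_bound[of "ac_poly g"] assms(1) by simp
  then have "\<not> inj_on ?c {..degree g}"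
    using card_inj_on_le[OF _ sub fin] by fastforce
  then obtain i j where ij: "i < j" "j \<le> degree g" "?c i = ?c j"
    by (auto simp: inj_on_def) (metis linorder_neqE_nat)
  have "?c i = (x ^ (CARD('a) ^ (j - i))) ^ (CARD('a) ^ i)"
    using ij by (simp flip: power_frobenius_add)
  then have "x \<in> fixed_field (j - i)" by (simp add: frobenius_ac_inj fixed_field_def)
  then show ?thesis using that[of "j - i"] ij by simp
qed

text \<open>
  The factor \<open>n\<close> is the number of roots of \<open>g\<close>, counted by the pairs of a root \<open>x\<close> and an exponent \<open>j > 0\<close>
  such that the \<open>j\<close>-th power of the minimal polynomial of \<open>x\<close> divides \<open>g\<close>.
\<close>
lemma L_coeff_newton:
  fixes \<psi> :: "'a::{finite,field} \<Rightarrow> complex"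
  assumes \<psi>: "add_char \<psi>"
  shows "of_nat n * L_coeff \<psi> f n = (\<Sum>i=1..n. ext_sum \<psi> f i * L_coeff \<psi> f (n - i))"
proof -
  \<comment> \<open>A finite set containing every root of every monic polynomial of degree n,
    independent of the polynomial, so that the sums can be interchanged.\<close>
  define U where "U = (\<Union>i\<in>{1..n}. fixed_field i :: 'a alg_closure set)"
  have finU: "finite U" by (auto simp: U_def finite_fixed_field)
  define lam where "lam g = \<psi> (root_trace f g)" for g
  have U: "0 < orbit_size x" "orbit_size x \<le> n" "lead_coeff (orbit_poly x) = 1"
      "degree (orbit_poly x) = orbit_size x" "orbit_poly x \<noteq> 0"
      "\<And>m. x \<in> fixed_field m \<longleftrightarrow> orbit_size x dvd m"
      "\<And>j. ac_trace (j * orbit_size x) (poly (ac_poly f) x) = to_ac (of_nat j * root_trace f (orbit_poly x))"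
      "\<And>g j. g \<noteq> 0 \<Longrightarrow> orbit_poly x ^ j dvd g \<longleftrightarrow> j \<le> order x (ac_poly g)"
    if "x \<in> U" for x
  proof -
    from that obtain i where i: "x \<in> fixed_field i" "0 < i" "i \<le> n" by (auto simp: U_def)
    note i' = i(1,2)
    show "0 < orbit_size x" by (rule orbit_size_pos[OF i'])
    show "lead_coeff (orbit_poly x) = 1" by (rule lead_coeff_orbit_poly[OF i'])
    show "degree (orbit_poly x) = orbit_size x" by (rule degree_orbit_poly[OF i'])
    show "orbit_poly x \<noteq> 0" by (rule orbit_poly_nonzero[OF i'])
    show "x \<in> fixed_field m \<longleftrightarrow> orbit_size x dvd m" for m by (rule fixed_field_iff_dvd[OF i'])
    show "ac_trace (j * orbit_size x) (poly (ac_poly f) x) = to_ac (of_nat j * root_trace f (orbit_poly x))" for j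
      by (rule ac_trace_orbit[OF i'])
    show "orbit_poly x ^ j dvd g \<longleftrightarrow> j \<le> order x (ac_poly g)" if "g \<noteq> 0" for g j
      using that by (rule orbit_poly_power_dvd_iff[OF i'])
    show "orbit_size x \<le> n" using orbit_size_le[OF i'] i(3) by simp
  qed
  have deg: "n = (\<Sum>x\<in>U. card {j\<in>{1..n}. orbit_poly x ^ j dvd g})" if g: "g \<in> monics n" for g
  proof -
    have nz: "g \<noteq> 0" and dg: "degree g = n" using g by (auto simp: monics_def)
    have roots: "{x. poly (ac_poly g) x = 0} \<subseteq> U"
    proof
      fix x assume "x \<in> {x. poly (ac_poly g) x = 0}"
      then have "poly (ac_poly g) x = 0" by simp
      from root_in_fixed_field[OF nz this] obtain i where "0 < i" "i \<le> degree g" "x \<in> fixed_field i" .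
      then show "x \<in> U" unfolding U_def dg by (intro UN_I[of i]) simp_all
    qed
    have "n = (\<Sum>x | poly (ac_poly g) x = 0. order x (ac_poly g))"
      using sum_order_alg_closed[of "ac_poly g"] nz dg by simp
    also have "\<dots> = (\<Sum>x\<in>U. order x (ac_poly g))"
      using nz by (intro sum.mono_neutral_left finU roots) (auto simp: order_0I)
    also have "\<dots> = (\<Sum>x\<in>U. card {j\<in>{1..n}. orbit_poly x ^ j dvd g})"
    proof (intro sum.cong refl)
      fix x assume x: "x \<in> U"
      have "order x (ac_poly g) \<le> n" using order_degree[of "ac_poly g" x] nz dg by simp
      then have "{j\<in>{1..n}. j \<le> order x (ac_poly g)} = {1..order x (ac_poly g)}" by auto
      then have "{j\<in>{1..n}. orbit_poly x ^ j dvd g} = {1..order x (ac_poly g)}"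
        by (simp only: U(8)[OF x nz])
      then show "order x (ac_poly g) = card {j\<in>{1..n}. orbit_poly x ^ j dvd g}" by simp
    qed
    finally show ?thesis .
  qed
  have "of_nat n * L_coeff \<psi> f n = (\<Sum>g\<in>monics n. \<Sum>x\<in>U. \<Sum>j=1..n. if orbit_poly x ^ j dvd g then lam g else 0)"
  proof -
    have "of_nat n * lam g = (\<Sum>x\<in>U. \<Sum>j=1..n. if orbit_poly x ^ j dvd g then lam g else 0)" if g: "g \<in> monics n" for g
    proof -
      have "of_nat n * lam g = (\<Sum>x\<in>U. of_nat (card {j\<in>{1..n}. orbit_poly x ^ j dvd g}) * lam g)"
        by (subst deg[OF g]) (simp add: sum_distrib_right)
      also have "\<dots> = (\<Sum>x\<in>U. \<Sum>j=1..n. if orbit_poly x ^ j dvd g then lam g else 0)"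
        by (intro sum.cong refl) (simp flip: sum.inter_filter)
      finally show ?thesis .
    qed
    then show ?thesis by (simp add: L_coeff_def sum_distrib_left lam_def)
  qed
  also have "\<dots> = (\<Sum>x\<in>U. \<Sum>j=1..n. \<Sum>g\<in>monics n. if orbit_poly x ^ j dvd g then lam g else 0)"
    by (subst sum.swap) (intro sum.cong refl sum.swap)
  also have "\<dots> = (\<Sum>x\<in>U. \<Sum>j=1..n. if j * orbit_size x \<le> n then lam (orbit_poly x) ^ j * L_coeff \<psi> f (n - j * orbit_size x) else 0)"
  proof (intro sum.cong refl)
    fix x and j :: nat assume x: "x \<in> U"
    have lc: "lead_coeff (orbit_poly x ^ j) = 1" using U(3)[OF x] by (simp add: lead_coeff_power)
    have dg: "degree (orbit_poly x ^ j) = j * orbit_size x"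
      using U(4,5)[OF x] by (simp add: degree_power_eq)
    have pw: "\<psi> (root_trace f (orbit_poly x ^ j)) = lam (orbit_poly x) ^ j"
      using U(5)[OF x] by (simp add: root_trace_power add_char_of_nat_mult[OF \<psi>] lam_def)
    show "(\<Sum>g\<in>monics n. if orbit_poly x ^ j dvd g then lam g else 0)
      = (if j * orbit_size x \<le> n then lam (orbit_poly x) ^ j * L_coeff \<psi> f (n - j * orbit_size x) else 0)"
      using sum_monics_dvd[OF \<psi> lc, where n = n and f = f] unfolding dg pw
      by (simp add: lam_def finite_monics flip: sum.inter_filter)
  qed
  \<comment> \<open>For fixed x, substitute i = j * \<open>orbit_size x\<close>: these are the
    degrees of the extensions containing x, and the j-th power of the character value becomes the
    character of the trace.\<close>
  also have "\<dots> = (\<Sum>x\<in>U. \<Sum>i=1..n. if x \<in> fixed_field i then \<psi> (of_ac (ac_trace i (poly (ac_poly f) x))) * L_coeff \<psi> f (n - i) else 0)"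
  proof (rule sum.cong[OF refl])
    fix x assume x: "x \<in> U"
    let ?e = "orbit_size x"
    have "(\<Sum>i=1..n. if x \<in> fixed_field i then \<psi> (of_ac (ac_trace i (poly (ac_poly f) x))) * L_coeff \<psi> f (n - i) else 0)
      = (\<Sum>i | i \<in> {1..n} \<and> ?e dvd i. \<psi> (of_ac (ac_trace i (poly (ac_poly f) x))) * L_coeff \<psi> f (n - i))"
      unfolding U(6)[OF x] by (simp flip: sum.inter_filter)
    also have "\<dots> = (\<Sum>j | j \<in> {1..n} \<and> j * ?e \<le> n. lam (orbit_poly x) ^ j * L_coeff \<psi> f (n - j * ?e))"
    proof (rule sum.reindex_bij_witness[of _ "\<lambda>j. j * ?e" "\<lambda>i. i div ?e"])
      fix i assume "i \<in> {i. i \<in> {1..n} \<and> ?e dvd i}"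
      then obtain k where k: "i = ?e * k" "1 \<le> i" "i \<le> n" by auto
      moreover have "k \<le> n"
      proof -
        have "1 * k \<le> ?e * k" using U(1)[OF x] by (intro mult_le_mono1) simp
        then show ?thesis using k by linarith
      qed
      ultimately show "i div ?e * ?e = i" "i div ?e \<in> {j. j \<in> {1..n} \<and> j * ?e \<le> n}"
        using U(1)[OF x] by (auto simp: mult.commute Suc_le_eq)
    next
      fix j assume j: "j \<in> {j. j \<in> {1..n} \<and> j * ?e \<le> n}"
      then show "j * ?e div ?e = j" "j * ?e \<in> {i. i \<in> {1..n} \<and> ?e dvd i}"
        using U(1)[OF x] by auto
    next
      fix i assume "i \<in> {i. i \<in> {1..n} \<and> ?e dvd i}"
      then have i: "i div ?e * ?e = i" by simp
      have tr: "ac_trace i (poly (ac_poly f) x) = to_ac (of_nat (i div ?e) * root_trace f (orbit_poly x))"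
        using U(7)[OF x, of "i div ?e"] unfolding i .
      then show "lam (orbit_poly x) ^ (i div ?e) * L_coeff \<psi> f (n - i div ?e * ?e)
          = \<psi> (of_ac (ac_trace i (poly (ac_poly f) x))) * L_coeff \<psi> f (n - i)"
        unfolding i tr of_ac_to_ac by (simp add: lam_def add_char_of_nat_mult[OF \<psi>])
    qed
    finally show "(\<Sum>j=1..n. if j * ?e \<le> n then lam (orbit_poly x) ^ j * L_coeff \<psi> f (n - j * ?e) else 0)
      = (\<Sum>i=1..n. if x \<in> fixed_field i then \<psi> (of_ac (ac_trace i (poly (ac_poly f) x))) * L_coeff \<psi> f (n - i) else 0)"
      by (simp flip: sum.inter_filter)
  qed
  also have "\<dots> = (\<Sum>i=1..n. \<Sum>x\<in>U. if x \<in> fixed_field i then \<psi> (of_ac (ac_trace i (poly (ac_poly f) x))) * L_coeff \<psi> f (n - i) else 0)"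
    by (rule sum.swap)
  also have "\<dots> = (\<Sum>i=1..n. ext_sum \<psi> f i * L_coeff \<psi> f (n - i))"
  proof (intro sum.cong refl)
    fix i assume "i \<in> {1..n}"
    then have "{x \<in> U. x \<in> fixed_field i} = fixed_field i" by (auto simp: U_def)
    then show "(\<Sum>x\<in>U. if x \<in> fixed_field i then \<psi> (of_ac (ac_trace i (poly (ac_poly f) x))) * L_coeff \<psi> f (n - i) else 0)
      = ext_sum \<psi> f i * L_coeff \<psi> f (n - i)"
      using finU by (simp add: ext_sum_def sum_distrib_right flip: sum.inter_filter)
  qed
  finally show ?thesis .
qed

subsection \<open>Stepanov's method\<close>

text \<open>The nonzero term of highest degree cannot be cancelled by the others.\<close>

lemma sum_distinct_degrees_nonzero:
  fixes p :: "'i \<Rightarrow> 'b::comm_ring_1 poly"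
  assumes "finite I" "inj_on (\<lambda>i. degree (p i)) {i\<in>I. p i \<noteq> 0}" "k \<in> I" "p k \<noteq> 0"
  shows "(\<Sum>i\<in>I. p i) \<noteq> 0"
proof -
  let ?J = "{i\<in>I. p i \<noteq> 0}"
  have J: "finite ?J" "?J \<noteq> {}" using assms by auto
  then have "Max ((\<lambda>i. degree (p i)) ` ?J) \<in> (\<lambda>i. degree (p i)) ` ?J" by (intro Max_in) simp_all
  then obtain m where m: "Max ((\<lambda>i. degree (p i)) ` ?J) = degree (p m)" "m \<in> ?J" by (rule imageE)
  have "coeff (p i) (degree (p m)) = 0" if "i \<in> I - {m}" for i
  proof (cases "p i = 0")
    case False
    then have i: "i \<in> ?J" using that by simp
    then have "degree (p i) \<le> degree (p m)" unfolding m(1)[symmetric] using J by (intro Max_ge) simp_all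
    moreover have "degree (p i) \<noteq> degree (p m)" using inj_onD[OF assms(2) _ i m(2)] that by auto
    ultimately show ?thesis by (intro coeff_eq_0) simp
  qed simp
  then have "coeff (\<Sum>i\<in>I. p i) (degree (p m)) = lead_coeff (p m)"
    using m(2) assms(1) by (simp add: coeff_sum sum.remove[of I m])
  then show ?thesis using m(2) by auto
qed

lemma mult_add_coprime_unique:
  fixes q d :: nat
  assumes "coprime q d" "j < q" "j' < q" "q * i + d * j = q * i' + d * j'"
  shows "i = i' \<and> j = j'"
proof -
  have "int (q * i + d * j) = int (q * i' + d * j')" using assms(4) by simp
  then have "int d * (int j - int j') = int q * (int i' - int i)" by (simp add: algebra_simps)
  then have "int q dvd int d * (int j - int j')" by simp
  moreover have "coprime (int q) (int d)" using assms(1) by simp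
  ultimately have "int q dvd int j - int j'" by (simp add: coprime_dvd_mult_right_iff)
  then have "j = j'" using assms(2,3) zdvd_imp_le[of "int q" "int j - int j'"] zdvd_imp_le[of "int q" "int j' - int j"]
    by (cases j j' rule: linorder_cases) (auto simp: dvd_diff_commute)
  then show ?thesis using assms(2,4) by simp
qed

text \<open>The left side is the number of coefficients available to H in Stepanov's construction,
  the right side the number of unknowns.\<close>

lemma stepanov_dimension_count:
  fixes q r d :: nat
  assumes "2 \<le> q" "1 \<le> r"
  shows "Suc ((r - 1) * (q * r) + (r + d) + (q - 1) * (d * r)) < r * (Suc (r + d) * q)"
proof -
  obtain s t where st: "q = Suc (Suc s)" "r = Suc t"
    using assms by (metis Suc_le_D numeral_2_eq_2 Suc_le_mono One_nat_def)
  show ?thesis unfolding st by (simp add: algebra_simps)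
qed

text \<open>At a point x, the trace of f(x) from degree 2n is the value of this polynomial plus its
  q^n-th power.\<close>

definition half_trace :: "'a::{finite,field} poly \<Rightarrow> nat \<Rightarrow> 'a poly" where
  "half_trace f n = (\<Sum>t<n. f ^ (CARD('a) ^ t))"

text \<open>
  With \<open>R = q^\<mu>\<close> and \<open>g = half_trace f \<mu>\<close>, every \<open>x\<close> in the field with \<open>R\<^sup>2\<close> elements at which \<open>f\<close> has
  trace \<open>a\<close> satisfies \<open>x^(R\<^sup>2) = x\<close> and \<open>g(x)^R = a - g(x)\<close>. Hence the \<open>R\<close>-th power of
  \<open>G = \<Sum> c\<^sub>l\<^sub>i\<^sub>j x^(l + i R) g^j\<close> agrees at \<open>x\<close> with \<open>H = \<Sum> c\<^sub>l\<^sub>i\<^sub>j x^(l R + i) (a - g)^j\<close>, which has much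
  smaller degree, and the pigeonhole principle yields \<open>c \<noteq> 0\<close> with \<open>H = 0\<close>. As the terms of \<open>G\<close> have distinct
  degrees, \<open>G\<close> is a nonzero polynomial vanishing at all these \<open>x\<close>.
\<close>
context
  fixes f :: "'a::{finite,field} poly" and \<mu> :: nat and a :: 'a
  assumes d: "0 < degree f" and coprime: "coprime (CARD('a)) (degree f)" and \<mu>: "0 < \<mu>"
begin

lemma degree_half_trace: "degree (half_trace f \<mu>) = degree f * CARD('a) ^ (\<mu> - 1)"
proof -
  obtain k where k: "\<mu> = Suc k" using \<mu> by (cases \<mu>) simp_all
  have f0: "f \<noteq> 0" using d by auto
  have "degree (\<Sum>t<k. f ^ (CARD('a) ^ t)) < degree (f ^ (CARD('a) ^ k))"
    using CARD_field_ge_2[where 'a='a] d f0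
    by (intro degree_sum_less) (simp_all add: degree_power_eq)
  then show ?thesis
    unfolding half_trace_def k using f0 by (simp add: degree_add_eq_right degree_power_eq mult.commute)
qed

lemma half_trace_frobenius:
  assumes "ac_trace (2 * \<mu>) (poly (ac_poly f) x) = to_ac a"
  shows "poly (ac_poly (half_trace f \<mu>)) x ^ (CARD('a) ^ \<mu>) = to_ac a - poly (ac_poly (half_trace f \<mu>)) x"
proof -
  let ?y = "poly (ac_poly f) x"
  have h: "poly (ac_poly (half_trace f \<mu>)) x = (\<Sum>t<\<mu>. ?y ^ (CARD('a) ^ t))"
    by (simp add: half_trace_def ac_poly_sum ac_poly_power poly_sum)
  have "(\<Sum>t<\<mu>. ?y ^ (CARD('a) ^ t)) ^ (CARD('a) ^ \<mu>) = (\<Sum>t<\<mu>. ?y ^ (CARD('a) ^ (t + \<mu>)))"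
    by (simp add: freshmans_dream_ac_sum power_frobenius_add)
  also have "\<dots> = (\<Sum>t\<in>{\<mu>..<2 * \<mu>}. ?y ^ (CARD('a) ^ t))"
    using sum.shift_bounds_nat_ivl[of "\<lambda>t. ?y ^ (CARD('a) ^ t)" 0 \<mu> \<mu>]
    by (simp add: atLeast0LessThan mult_2)
  also have "\<dots> = to_ac a - (\<Sum>t<\<mu>. ?y ^ (CARD('a) ^ t))"
    using assms sum.atLeastLessThan_concat[of 0 \<mu> "2 * \<mu>" "\<lambda>t. ?y ^ (CARD('a) ^ t)"]
    by (simp add: ac_trace_def atLeast0LessThan algebra_simps)
  finally show ?thesis unfolding h .
qed

lemma stepanov_count:
  "card {x \<in> fixed_field (2 * \<mu>). ac_trace (2 * \<mu>) (poly (ac_poly f) x) = to_ac a}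
     \<le> CARD('a) ^ (2 * \<mu> - 1) + (2 * degree f + 1) * CARD('a) ^ \<mu>" (is "card ?N \<le> _")
proof -
  let ?q = "CARD('a)" and ?d = "degree f"
  define r R where "r = ?q ^ (\<mu> - 1)" and "R = ?q ^ \<mu>"
  have q2: "?q \<ge> 2" by (rule CARD_field_ge_2)
  have R: "R = ?q * r" using \<mu> by (simp add: R_def r_def flip: power_Suc)
  have r: "1 \<le> r" using q2 by (simp add: r_def)
  \<comment> \<open>The range of i is large enough for the unknowns to outnumber the coefficients of
    H; j < q allows i and j to be recovered from q i + d j.\<close>
  define I where "I = {..<r} \<times> {..r + ?d} \<times> {..<?q}"
  have finI: "finite I" by (simp add: I_def)
  define u where "u = (\<lambda>(l, i, j). monom 1 (l * R + i) * ([:a:] - half_trace f \<mu>) ^ j)"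
  define v where "v = (\<lambda>(l, i, j). monom 1 (l + i * R) * (half_trace f \<mu>) ^ j)"
  define H where "H c = (\<Sum>k\<in>I. smult (c k) (u k))" for c :: "nat \<times> nat \<times> nat \<Rightarrow> 'a"
  define G where "G c = (\<Sum>k\<in>I. smult (c k) (v k))" for c :: "nat \<times> nat \<times> nat \<Rightarrow> 'a"
  have dh: "degree (half_trace f \<mu>) = ?d * r" by (simp add: degree_half_trace r_def)
  then have dh': "degree ([:a:] - half_trace f \<mu>) \<le> ?d * r" by (intro degree_diff_le) simp_all
  have h0: "half_trace f \<mu> \<noteq> 0" using dh d r by (metis degree_0 mult_is_0 not_one_le_zero less_irrefl)
  define B where "B = (r - 1) * (?q * r) + (r + ?d) + (?q - 1) * (?d * r)"
  have degH: "degree (H c) \<le> B" for c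
    unfolding H_def
  proof (rule degree_sum_le[OF finI])
    fix k assume "k \<in> I"
    then obtain l i j where k: "k = (l, i, j)" "l < r" "i \<le> r + ?d" "j < ?q" by (auto simp: I_def)
    have "degree (smult (c k) (u k)) \<le> (l * R + i) + degree (([:a:] - half_trace f \<mu>) ^ j)"
      unfolding k(1) u_def by (auto intro!: order_trans[OF degree_smult_le] order_trans[OF degree_mult_le] degree_monom_le add_mono)
    also have "\<dots> \<le> (l * R + i) + j * (?d * r)"
    proof (rule add_left_mono)
      have "degree (([:a:] - half_trace f \<mu>) ^ j) \<le> degree ([:a:] - half_trace f \<mu>) * j" by (rule degree_power_le)
      also have "\<dots> \<le> j * (?d * r)" using mult_le_mono1[OF dh', of j] by (simp only: mult.commute)
      finally show "degree (([:a:] - half_trace f \<mu>) ^ j) \<le> j * (?d * r)" .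
    qed
    also have "\<dots> \<le> (r - 1) * R + (r + ?d) + (?q - 1) * (?d * r)"
      using k(2-4) by (intro add_mono mult_le_mono1) simp_all
    finally show "degree (smult (c k) (u k)) \<le> B" by (simp add: B_def R)
  qed
  \<comment> \<open>Pigeonhole on finite sets replaces linear algebra: there are more coefficient
    families than polynomials of degree at most \<open>B\<close>, and the difference of two families
    with equal image lies in the kernel.\<close>
  have "\<not> inj_on H (I \<rightarrow>\<^sub>E UNIV)"
  proof
    assume "inj_on H (I \<rightarrow>\<^sub>E UNIV)"
    moreover have "H ` (I \<rightarrow>\<^sub>E UNIV) \<subseteq> {p. degree p \<le> B}"
      by (intro image_subsetI) (simp add: degH)
    ultimately have "card (I \<rightarrow>\<^sub>E (UNIV :: 'a set)) \<le> card {p :: 'a poly. degree p \<le> B}"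
      by (rule card_inj_on_le[OF _ _ card_poly_degree_le(1)])
    also have "\<dots> \<le> ?q ^ Suc B" by (rule card_poly_degree_le(2))
    also have "\<dots> < ?q ^ card I"
    proof (rule power_strict_increasing)
      show "Suc B < card I"
        using stepanov_dimension_count[OF q2 r, of ?d] unfolding B_def I_def
        by (simp only: card_cartesian_product card_lessThan card_atMost)
    qed (use q2 in linarith)
    also have "\<dots> = card (I \<rightarrow>\<^sub>E (UNIV :: 'a set))" using finI by (simp add: card_PiE)
    finally show False by simp
  qed
  then obtain c1 c2 where c12: "c1 \<in> I \<rightarrow>\<^sub>E UNIV" "c2 \<in> I \<rightarrow>\<^sub>E UNIV" "H c1 = H c2" "c1 \<noteq> c2"
    by (auto simp: inj_on_def)
  define c where "c k = c1 k - c2 k" for k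
  have "H c = H c1 - H c2" by (simp add: H_def c_def smult_diff_left sum_subtractf)
  then have Hc: "H c = 0" using c12(3) by simp
  obtain k where k: "k \<in> I" "c k \<noteq> 0"
    using PiE_ext[OF c12(1,2)] c12(4) by (auto simp: c_def)
  have degv: "degree (v (l, i, j)) = l + r * (?q * i + ?d * j)" for l i j
    using h0 by (simp add: v_def degree_mult_eq degree_monom_eq degree_power_eq dh R algebra_simps)
  have v0: "v k \<noteq> 0" for k using h0 by (simp add: v_def split: prod.split)
  have "G c \<noteq> 0"
    unfolding G_def
  proof (rule sum_distinct_degrees_nonzero[OF finI _ k(1)])
    show "smult (c k) (v k) \<noteq> 0" using k(2) v0 by simp
    show "inj_on (\<lambda>k. degree (smult (c k) (v k))) {k \<in> I. smult (c k) (v k) \<noteq> 0}"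
    proof (rule inj_onI, clarsimp)
      fix l i j l' i' j'
      assume "(l, i, j) \<in> I" "(l', i', j') \<in> I" and "degree (v (l, i, j)) = degree (v (l', i', j'))"
      then have eq: "l + r * (?q * i + ?d * j) = l' + r * (?q * i' + ?d * j')" "l < r" "l' < r" "j < ?q" "j' < ?q"
        unfolding degv by (simp_all add: I_def)
      \<comment> \<open>Since l < r, reducing the degree modulo r recovers l; coprimality of q and d
        then separates i and j.\<close>
      have "l = l'" using arg_cong[OF eq(1), of "\<lambda>x. x mod r"] eq(2,3) by simp
      moreover from this eq(1) r have "?q * i + ?d * j = ?q * i' + ?d * j'" by simp
      ultimately show "l = l' \<and> i = i' \<and> j = j'"
        using mult_add_coprime_unique[OF coprime eq(4,5)] by simp
    qed
  qed
  have "?N \<subseteq> {x. poly (ac_poly (G c)) x = 0}"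
  proof clarify
    fix x assume x: "x \<in> fixed_field (2 * \<mu>)" and tr: "ac_trace (2 * \<mu>) (poly (ac_poly f) x) = to_ac a"
    let ?y = "poly (ac_poly (half_trace f \<mu>)) x"
    have xR: "(x ^ R) ^ R = x"
      using x by (simp add: R_def fixed_field_def mult_2 flip: power_add power_mult)
    have yR: "?y ^ R = to_ac a - ?y" unfolding R_def by (rule half_trace_frobenius[OF tr])
    have cR: "to_ac (b :: 'a) ^ R = to_ac b" for b by (simp add: R_def power_CARD_power_eq_self flip: to_ac_power)
    have vR: "poly (ac_poly (v k)) x ^ R = poly (ac_poly (u k)) x" for k
    proof -
      obtain l i j where k: "k = (l, i, j)" by (cases k)
      have "poly (ac_poly (v k)) x ^ R = (x ^ (l + i * R) * ?y ^ j) ^ R"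
        by (simp add: k v_def ac_poly_mult ac_poly_power map_poly_monom poly_monom)
      also have "\<dots> = (x ^ R) ^ l * ((x ^ R) ^ R) ^ i * (?y ^ R) ^ j"
        by (simp add: power_mult_distrib power_add ac_simps flip: power_mult)
      also have "\<dots> = x ^ (l * R + i) * (to_ac a - ?y) ^ j"
        unfolding xR yR by (simp add: power_add mult.commute flip: power_mult)
      also have "\<dots> = poly (ac_poly (u k)) x"
      proof -
        have "ac_poly ([:a:] - half_trace f \<mu>) = [:to_ac a:] - ac_poly (half_trace f \<mu>)"
          by (rule poly_eqI) (simp add: coeff_map_poly coeff_pCons split: nat.split)
        then show ?thesis by (simp add: k u_def ac_poly_mult ac_poly_power map_poly_monom poly_monom)
      qed
      finally show ?thesis .
    qed
    have sm: "poly (ac_poly (smult b p)) x = to_ac b * poly (ac_poly p) x" for b :: 'a and p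
      by (simp add: map_poly_smult)
    have "poly (ac_poly (G c)) x ^ R = (\<Sum>k\<in>I. (to_ac (c k) * poly (ac_poly (v k)) x) ^ R)"
      unfolding G_def R_def by (simp add: ac_poly_sum poly_sum sm freshmans_dream_ac_sum)
    also have "\<dots> = poly (ac_poly (H c)) x"
      by (simp add: H_def power_mult_distrib cR vR ac_poly_sum poly_sum sm)
    finally show "poly (ac_poly (G c)) x = 0" using Hc by simp
  qed
  then have "card ?N \<le> card {x. poly (ac_poly (G c)) x = 0}"
    using \<open>G c \<noteq> 0\<close> by (intro card_mono poly_roots_finite) simp_all
  also have "\<dots> \<le> degree (G c)"
    using card_poly_roots_bound[of "ac_poly (G c)"] \<open>G c \<noteq> 0\<close> by simp
  also have "\<dots> \<le> r + (r + ?d) * R + ?d * R"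
    unfolding G_def
  proof (rule degree_sum_le[OF finI])
    fix k assume "k \<in> I"
    then obtain l i j where k: "k = (l, i, j)" "l < r" "i \<le> r + ?d" "j < ?q" by (auto simp: I_def)
    have "degree (smult (c k) (v k)) \<le> l + i * R + ?d * (j * r)"
      using degree_smult_le[of "c k" "v k"] unfolding k(1) degv by (simp add: R algebra_simps)
    also have "\<dots> \<le> r + (r + ?d) * R + ?d * R"
      unfolding R using k by (intro add_mono mult_le_mono) simp_all
    finally show "degree (smult (c k) (v k)) \<le> r + (r + ?d) * R + ?d * R" .
  qed
  also have "\<dots> \<le> r * R + (2 * ?d + 1) * R"
    using q2 by (simp add: R algebra_simps)
  also have "r * R = ?q ^ (2 * \<mu> - 1)"
    using \<mu> by (simp add: r_def R_def mult_2 flip: power_add)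
  finally show ?thesis by (simp add: R_def)
qed

end

text \<open>Stepanov's method bounds each trace fibre \<open>N b\<close> only from above, by
  \<open>B\<close>. As the character sums to 0, \<open>N b\<close> may be replaced by the deficit
  \<open>B - N b\<close>; deficits are nonnegative and total q B - q^(2 \<mu>), which has order
  q^\<mu>.\<close>

lemma ext_sum_bound:
  fixes \<psi> :: "'a::{finite,field} \<Rightarrow> complex"
  assumes \<psi>: "add_char \<psi>" "\<psi> z \<noteq> 1"
    and f: "0 < degree f" "coprime (CARD('a)) (degree f)" and \<mu>: "0 < \<mu>"
  shows "norm (ext_sum \<psi> f (2 * \<mu>)) \<le> real ((2 * degree f + 1) * CARD('a)) * real (CARD('a)) ^ \<mu>"
proof -
  let ?q = "CARD('a)" and ?F = "fixed_field (2 * \<mu>) :: 'a alg_closure set"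
  define t where "t x = of_ac (ac_trace (2 * \<mu>) (poly (ac_poly f) x))" for x
  define N where "N b = card {x \<in> ?F. t x = b}" for b
  define B where "B = ?q ^ (2 * \<mu> - 1) + (2 * degree f + 1) * ?q ^ \<mu>"
  have fin: "finite ?F" using \<mu> by (intro finite_fixed_field) simp
  have N: "N b \<le> B" for b
  proof -
    have "t x = b \<longleftrightarrow> ac_trace (2 * \<mu>) (poly (ac_poly f) x) = to_ac b" if "x \<in> ?F" for x
      using to_ac_of_ac_fixed[OF ac_trace_fixed[OF fixed_field_poly[OF that]], of f] by (auto simp: t_def)
    then have "{x \<in> ?F. t x = b} = {x \<in> ?F. ac_trace (2 * \<mu>) (poly (ac_poly f) x) = to_ac b}" by blast
    then show ?thesis using stepanov_count[OF f \<mu>, of b] by (simp add: N_def B_def)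
  qed
  have sumN: "(\<Sum>b\<in>UNIV. N b) = ?q ^ (2 * \<mu>)"
    using sum.group[OF fin, of UNIV t "\<lambda>_. 1 :: nat"] card_fixed_field[of "2 * \<mu>", where 'a='a] \<mu>
    by (simp add: N_def)
  have "ext_sum \<psi> f (2 * \<mu>) = (\<Sum>b\<in>UNIV. \<Sum>x\<in>{x \<in> ?F. t x = b}. \<psi> (t x))"
    unfolding ext_sum_def t_def[symmetric] using sum.group[OF fin, of UNIV t "\<lambda>x. \<psi> (t x)"] by simp
  also have "\<dots> = (\<Sum>b\<in>UNIV. of_nat (N b) * \<psi> b)" by (simp add: N_def)
  also have "\<dots> = - (\<Sum>b\<in>UNIV. of_nat (B - N b) * \<psi> b)"
    using add_char_sum_eq_0[OF \<psi>] N
    by (simp add: of_nat_diff left_diff_distrib sum_subtractf flip: sum_distrib_left)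
  finally have "norm (ext_sum \<psi> f (2 * \<mu>)) \<le> (\<Sum>b\<in>UNIV. norm (of_nat (B - N b) * \<psi> b))"
    by (simp add: norm_sum)
  also have "\<dots> = (\<Sum>b\<in>UNIV. real B - real (N b))"
  proof (intro sum.cong refl)
    fix b
    have "norm (of_nat (B - N b) * \<psi> b) = real (B - N b)"
      by (simp only: norm_mult norm_of_nat add_char_norm[OF \<psi>(1)] mult_1_right)
    then show "norm (of_nat (B - N b) * \<psi> b) = real B - real (N b)" using N[of b] by (simp only: of_nat_diff)
  qed
  also have "\<dots> = real (?q * B) - real (?q ^ (2 * \<mu>))"
    unfolding sum_subtractf of_nat_sum[symmetric] sumN by simp
  also have "?q * B = ?q ^ (2 * \<mu>) + (2 * degree f + 1) * ?q * ?q ^ \<mu>"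
  proof -
    have "?q * ?q ^ (2 * \<mu> - 1) = ?q ^ (2 * \<mu>)" using \<mu> by (simp flip: power_Suc)
    then show ?thesis unfolding B_def distrib_left by (simp add: algebra_simps)
  qed
  finally show ?thesis by simp
qed

subsection \<open>Weil's bound\<close>

lemma norm_sum_mset_le:
  fixes A :: "complex multiset"
  assumes "\<And>w. w \<in># A \<Longrightarrow> norm w \<le> B"
  shows "norm (\<Sum>w\<in>#A. w) \<le> real (size A) * B"
  using assms
proof (induction A)
  case (add w A)
  have "norm (w + (\<Sum>w\<in>#A. w)) \<le> norm w + norm (\<Sum>w\<in>#A. w)" by (rule norm_triangle_ineq)
  also have "\<dots> \<le> B + real (size A) * B" using add by (intro add_mono) simp_all
  finally show ?case by (simp add: algebra_simps)
qed simp

text \<open>A linear recurrence operator that annihilates all other terms isolates the contribution of \<open>z\<close>.\<close>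
lemma norm_le_of_power_sum_bound:
  fixes A :: "complex multiset"
  assumes "\<And>m. 0 < m \<Longrightarrow> norm (\<Sum>w\<in>#A. w ^ m) \<le> C * q ^ m" and "0 < q" "z \<in># A"
  shows "norm z \<le> q"
proof (rule ccontr)
  assume "\<not> norm z \<le> q"
  then have z: "norm z > q" by simp
  \<comment> \<open>The coefficients of h give the recurrence operator: h vanishes at every element
    of A except z.\<close>
  define h where "h = (\<Prod>w\<in>set_mset A - {z}. [:- w, 1:])"
  have hz: "poly h z \<noteq> 0" by (auto simp: h_def poly_prod)
  have hw: "poly h w = 0" if "w \<in># A" "w \<noteq> z" for w
    using that by (auto simp: h_def poly_prod)
  define K where "K = of_nat (count A z) * poly h z"
  have K: "norm K > 0" using hz assms(3) by (simp add: K_def)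
  have iso: "(\<Sum>j\<le>degree h. coeff h j * (\<Sum>w\<in>#A. w ^ (m + j))) = K * z ^ m" for m
  proof -
    have "(\<Sum>j\<le>degree h. coeff h j * (\<Sum>w\<in>#A. w ^ (m + j))) = (\<Sum>w\<in>#A. w ^ m * poly h w)"
    proof (induction A)
      case (add w A)
      have "(\<Sum>j\<le>degree h. coeff h j * (\<Sum>w\<in>#add_mset w A. w ^ (m + j)))
        = (\<Sum>j\<le>degree h. coeff h j * w ^ (m + j)) + (\<Sum>j\<le>degree h. coeff h j * (\<Sum>w\<in>#A. w ^ (m + j)))"
        by (simp add: distrib_left sum.distrib)
      also have "(\<Sum>j\<le>degree h. coeff h j * w ^ (m + j)) = w ^ m * poly h w"
        by (simp add: poly_altdef sum_distrib_left power_add algebra_simps)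
      finally show ?case using add by simp
    qed simp
    also have "\<dots> = (\<Sum>w\<in>#filter_mset (\<lambda>w. w = z) A + filter_mset (\<lambda>w. w \<noteq> z) A. w ^ m * poly h w)"
      by simp
    also have "\<dots> = (\<Sum>w\<in>#replicate_mset (count A z) z. w ^ m * poly h w)
        + (\<Sum>w\<in>#filter_mset (\<lambda>w. w \<noteq> z) A. w ^ m * poly h w)"
      by (simp only: image_mset_union sum_mset.union filter_eq_replicate_mset)
    also have "image_mset (\<lambda>w. w ^ m * poly h w) (filter_mset (\<lambda>w. w \<noteq> z) A)
        = image_mset (\<lambda>w. 0) (filter_mset (\<lambda>w. w \<noteq> z) A)"
      by (rule image_mset_cong) (simp add: hw)
    also have "(\<Sum>w\<in>#replicate_mset (count A z) z. w ^ m * poly h w) + sum_mset \<dots> = K * z ^ m"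
      by (simp add: K_def)
    finally show ?thesis .
  qed
  define T where "T = (\<Sum>j\<le>degree h. norm (coeff h j) * (C * q ^ j))"
  have bound: "norm K * norm z ^ m \<le> T * q ^ m" if "0 < m" for m
  proof -
    have "norm K * norm z ^ m = norm (\<Sum>j\<le>degree h. coeff h j * (\<Sum>w\<in>#A. w ^ (m + j)))"
      by (simp only: iso norm_mult norm_power)
    also have "\<dots> \<le> (\<Sum>j\<le>degree h. norm (coeff h j) * (C * q ^ (m + j)))"
      by (rule sum_norm_le) (use that in \<open>simp add: norm_mult mult_left_mono assms(1)\<close>)
    also have "\<dots> = T * q ^ m" unfolding T_def sum_distrib_right
      by (intro sum.cong refl) (simp add: power_add)
    finally show ?thesis .
  qed
  have "1 < norm z / q" using z assms(2) by simp
  from real_arch_pow[OF this, of "T / norm K"] obtain m where m: "T / norm K < (norm z / q) ^ m" by blast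
  also have "\<dots> \<le> (norm z / q) ^ Suc m" using \<open>1 < norm z / q\<close> by (intro power_increasing) simp_all
  finally have "T * q ^ Suc m < norm K * norm z ^ Suc m"
    using K assms(2) by (simp add: power_divide field_simps)
  then show False using bound[of "Suc m"] by simp
qed

lemma ext_sum_1: "ext_sum \<psi> f 1 = (\<Sum>x\<in>UNIV. \<psi> (poly f x))"
  unfolding ext_sum_def fixed_field_1
  by (subst sum.reindex[OF inj_to_ac]) (simp add: ac_trace_def)

lemma weil_additive:
  fixes \<psi> :: "'a::{finite,field} \<Rightarrow> complex"
  assumes \<psi>: "add_char \<psi>" "\<psi> z \<noteq> 1" and f: "\<not> CHAR('a) dvd degree f"
  shows "norm (\<Sum>x\<in>UNIV. \<psi> (poly f x)) \<le> (real (degree f) - 1) * sqrt (real (CARD('a)))"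
proof -
  let ?d = "degree f" and ?q = "CARD('a)"
  define D where "D = ?d - 1"
  have d: "0 < ?d" using f by (cases ?d) simp_all
  have d0: "(of_nat ?d :: 'a) \<noteq> 0" using f by (simp add: of_nat_eq_0_iff_char_dvd)
  have cop: "coprime ?q ?d"
  proof -
    obtain s where s: "?q = CHAR('a) ^ s" using CARD_eq_CHAR_power by blast
    show ?thesis
      unfolding s using f prime_CHAR_finite[where 'a='a] by (intro coprime_power_left_iff[THEN iffD2] disjI1 prime_imp_coprime)
  qed
  let ?L = "L_coeff \<psi> f" and ?S = "ext_sum \<psi> f"
  \<comment> \<open>The reversal of P is the L-function, a polynomial of degree at most d - 1 with
    constant term 1; thus P is monic of degree exactly d - 1.\<close>
  define P where "P = (\<Sum>k<?d. monom (?L (D - k)) k)"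
  have cP: "coeff P k = (if k < ?d then ?L (D - k) else 0)" for k by (simp add: P_def coeff_sum)
  have L0: "?L 0 = 1" by (rule L_coeff_0[OF \<psi>(1)])
  have degP: "degree P = D"
  proof (rule antisym)
    show "degree P \<le> D" by (rule degree_le) (auto simp: cP D_def)
    show "D \<le> degree P" by (rule le_degree) (use d in \<open>simp add: cP L0 D_def\<close>)
  qed
  have lcP: "lead_coeff P = 1" unfolding degP cP using d by (simp add: L0 D_def)
  then have P0: "P \<noteq> 0" by auto
  have R: "fps_of_poly (reflect_poly P) = Abs_fps ?L"
  proof (rule fps_ext)
    fix n
    show "fps_of_poly (reflect_poly P) $ n = Abs_fps ?L $ n"
    proof (cases "n \<le> D")
      case False
      then have "?L n = 0" by (intro L_coeff_eq_0[OF \<psi> d0]) (simp add: D_def)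
      then show ?thesis using False by (simp add: coeff_reflect_poly degP)
    qed (use d in \<open>simp add: coeff_reflect_poly degP cP D_def\<close>)
  qed
  let ?T = "Abs_fps (\<lambda>i. if i = 0 then 0 else ?S i)"
  \<comment> \<open>\<open>L_coeff_newton\<close> for generating series. Compared with Newton's
    identity for P, it makes the n-th power sum of P equal to -S_n for n > 0.\<close>
  have "fps_X * fps_deriv (Abs_fps ?L) = ?T * Abs_fps ?L"
  proof (rule fps_ext)
    fix n
    have "(?T * Abs_fps ?L) $ n = (\<Sum>i=0..n. (if i = 0 then 0 else ?S i) * ?L (n - i))"
      by (simp add: fps_mult_nth)
    also have "\<dots> = (\<Sum>i=1..n. ?S i * ?L (n - i))"
      by (rule sum.mono_neutral_cong_right) auto
    finally show "(fps_X * fps_deriv (Abs_fps ?L)) $ n = (?T * Abs_fps ?L) $ n"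
      unfolding fps_X_mult_deriv_nth by (simp add: L_coeff_newton[OF \<psi>(1)])
  qed
  then have "power_sums P = fps_const (of_nat D) - ?T"
    by (intro power_sums_unique[OF P0]) (simp add: R degP left_diff_distrib)
  then have ps: "?S n = - (power_sums P $ n)" if "0 < n" for n using that by simp
  obtain A where A: "size A = D" "P = (\<Prod>w\<in>#A. [:- w, 1:])"
    using alg_closed_imp_factorization[OF P0, unfolded lcP smult_1_left] unfolding degP by blast
  have S: "?S n = - (\<Sum>w\<in>#A. w ^ n)" if "0 < n" for n
    unfolding ps[OF that] A(2) power_sums_split ..
  have "norm w \<le> sqrt (real ?q)" if w: "w \<in># A" for w
  proof -
    \<comment> \<open>The estimate is available only for extensions of even degree, so it is applied
      to the squares of the roots.\<close>
    have "norm (w ^ 2) \<le> real ?q"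
    proof (rule norm_le_of_power_sum_bound)
      show "w ^ 2 \<in># image_mset (\<lambda>w. w ^ 2) A" using w by simp
      fix m :: nat assume m: "0 < m"
      have "(\<Sum>w\<in>#image_mset (\<lambda>w. w ^ 2) A. w ^ m) = - ?S (2 * m)"
        using m by (simp add: S image_mset.compositionality comp_def flip: power_mult)
      then show "norm (\<Sum>w\<in>#image_mset (\<lambda>w. w ^ 2) A. w ^ m) \<le> real ((2 * ?d + 1) * ?q) * real ?q ^ m"
        using ext_sum_bound[OF \<psi> d cop m] by simp
    qed simp
    then show ?thesis by (intro real_le_rsqrt) (simp add: norm_power)
  qed
  then have "norm (\<Sum>w\<in>#A. w) \<le> real D * sqrt (real ?q)"
    using norm_sum_mset_le[of A "sqrt (real ?q)"] A(1) by simp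
  moreover have "(\<Sum>x\<in>UNIV. \<psi> (poly f x)) = - (\<Sum>w\<in>#A. w)"
    using S[of 1] by (simp flip: ext_sum_1)
  ultimately show ?thesis using d by (simp add: D_def of_nat_diff)
qed

subsection \<open>Majorising elementary symmetric functions\<close>

lemma prod_one_plus_fps_nth:
  fixes u :: "'i \<Rightarrow> 'b::field"
  assumes "finite D"
  shows "(\<Prod>x\<in>D. 1 + fps_const (u x) * fps_X) $ k = (\<Sum>T | T \<subseteq> D \<and> card T = k. \<Prod>x\<in>T. u x)"
proof -
  have c: "(\<Prod>x\<in>T. fps_const (u x)) = fps_const (\<Prod>x\<in>T. u x)" for T
    by (induction T rule: infinite_finite_induct) simp_all
  have "(\<Prod>x\<in>D. fps_const (u x) * fps_X + 1) = (\<Sum>T\<in>Pow D. fps_const (\<Prod>x\<in>T. u x) * fps_X ^ card T)"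
    unfolding prod_add[OF assms] by (simp add: prod.distrib c)
  then have "(\<Prod>x\<in>D. 1 + fps_const (u x) * fps_X) $ k = (\<Sum>T\<in>Pow D. if card T = k then \<Prod>x\<in>T. u x else 0)"
    by (simp add: add.commute fps_sum_nth fps_X_power_nth if_distrib cong: if_cong) (auto intro!: sum.cong)
  also have "\<dots> = (\<Sum>T | T \<subseteq> D \<and> card T = k. \<Prod>x\<in>T. u x)"
    using assms by (simp add: Pow_def flip: sum.inter_filter)
  finally show ?thesis .
qed

text \<open>Newton's identities for the values -u, since 1 + u t = 1 - (-u) t; the signs disappear
  on taking norms.\<close>

lemma norm_elementary_symmetric_newton:
  fixes u :: "'i \<Rightarrow> complex"
  assumes "finite D"
  defines "e \<equiv> \<lambda>k. \<Sum>T | T \<subseteq> D \<and> card T = k. \<Prod>x\<in>T. u x"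
  shows "real k * norm (e k) \<le> (\<Sum>i=1..k. norm (\<Sum>x\<in>D. u x ^ i) * norm (e (k - i)))"
proof -
  let ?F = "\<Prod>x\<in>D. 1 + fps_const (u x) * fps_X"
  let ?P = "Abs_fps (\<lambda>n. if n = 0 then 0 else \<Sum>x\<in>D. (- u x) ^ n)"
  let ?A = "image_mset (\<lambda>x. - u x) (mset_set D)"
  have "Abs_fps (\<lambda>n. if n = 0 then 0 else \<Sum>a\<in>#?A. a ^ n) = ?P"
    by (rule fps_ext) (simp add: image_mset.compositionality comp_def flip: sum_unfold_sum_mset)
  moreover have "(\<Prod>a\<in>#?A. 1 - fps_const a * fps_X) = ?F"
    by (simp add: image_mset.compositionality comp_def flip: prod_unfold_prod_mset fps_const_neg)
  ultimately have "fps_X * fps_deriv ?F = - ?F * ?P"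
    using fps_X_mult_deriv_prod_mset[of ?A] by simp
  then have eq: "fps_X * fps_deriv ?F = - (?P * ?F)" by (simp add: mult.commute)
  have F: "?F $ k = e k" for k unfolding e_def by (rule prod_one_plus_fps_nth[OF assms(1)])
  have "of_nat k * e k = - ((?P * ?F) $ k)"
    using arg_cong[OF eq, of "\<lambda>F. F $ k"] unfolding fps_X_mult_deriv_nth F by simp
  also have "(?P * ?F) $ k = (\<Sum>i=0..k. (if i = 0 then 0 else \<Sum>x\<in>D. (- u x) ^ i) * e (k - i))"
    by (simp add: fps_mult_nth F)
  also have "\<dots> = (\<Sum>i=1..k. (-1) ^ i * (\<Sum>x\<in>D. u x ^ i) * e (k - i))"
    by (rule sum.mono_neutral_cong_right) (auto simp: power_minus[of "u _"] sum_distrib_left)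
  finally have "norm (of_nat k * e k) \<le> (\<Sum>i=1..k. norm ((-1) ^ i * (\<Sum>x\<in>D. u x ^ i) * e (k - i)))"
    by (simp add: norm_sum)
  then show ?thesis by (simp add: norm_mult norm_power)
qed

text \<open>Strong induction: enlarging the coefficients of Newton's recursion to nonnegative bounds
  can only enlarge its solution.\<close>

lemma newton_majorant:
  fixes e p :: "nat \<Rightarrow> real"
  assumes "\<And>k. real k * e k \<le> (\<Sum>i=1..k. p i * e (k - i))" "e 0 \<le> 1" "\<And>k. 0 \<le> e k"
    and "\<And>i. 0 < i \<Longrightarrow> p i \<le> b i" "\<And>i. 0 < i \<Longrightarrow> 0 \<le> b i"
    and "E 0 = 1" "\<And>k. real k * E k = (\<Sum>i=1..k. b i * E (k - i))"
  shows "e k \<le> E k"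
proof (induction k rule: less_induct)
  case (less k)
  show ?case
  proof (cases "k = 0")
    case False
    have "real k * e k \<le> (\<Sum>i=1..k. p i * e (k - i))" by (rule assms(1))
    also have "\<dots> \<le> (\<Sum>i=1..k. b i * E (k - i))"
    proof (rule sum_mono)
      fix i assume i: "i \<in> {1..k}"
      have "p i * e (k - i) \<le> b i * e (k - i)" using i assms(3,4) by (intro mult_right_mono) simp_all
      also have "\<dots> \<le> b i * E (k - i)" using i less False assms(5) by (intro mult_left_mono) simp_all
      finally show "p i * e (k - i) \<le> b i * E (k - i)" .
    qed
    also have "\<dots> = real k * E k" by (simp add: assms(7))
    finally show ?thesis using False by simp
  qed (use assms in simp)
qed

text \<open>The coefficient of \<open>t^n\<close> in \<open>(1 - t)^(-a)\<close>.\<close>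
definition multichoose :: "real \<Rightarrow> nat \<Rightarrow> real" where
  "multichoose a n = (a + real n - 1) gchoose n"

lemma multichoose_0 [simp]: "multichoose a 0 = 1"
  by (simp add: multichoose_def)

lemma multichoose_zero_left: "multichoose 0 n = (if n = 0 then 1 else 0)"
proof (cases n)
  case (Suc k)
  have "real (Suc k) * (real k gchoose Suc k) = 0"
    using gbinomial_absorb_comp[of "real k" k] gbinomial_absorption[of k "real k"]
    by (simp add: gbinomial_binomial[symmetric] binomial_gbinomial[symmetric])
  then show ?thesis using Suc by (simp add: multichoose_def)
qed simp

lemma multichoose_one_left: "multichoose 1 n = 1"
  by (simp add: multichoose_def flip: binomial_gbinomial)

lemma sum_multichoose: "(\<Sum>i\<le>n. multichoose a i) = multichoose (a + 1) n"
  using gbinomial_parallel_sum[of "a - 1" n] by (simp add: multichoose_def algebra_simps)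

text \<open>The coefficient form of t F' = F a t / (1 - t) for F = (1 - t)^(-a).\<close>

lemma multichoose_rec: "real n * multichoose a n = a * (\<Sum>i<n. multichoose a i)"
proof (cases n)
  case (Suc k)
  have "real (Suc k) * ((a + real k) gchoose Suc k) = (a + real k) * ((a + real k - 1) gchoose k)"
    using gbinomial_absorption[of k "a + real k"] by simp
  also have "\<dots> = a * ((a + real k) gchoose k)"
    using gbinomial_absorb_comp[of "a + real k" k] by simp
  also have "(a + real k) gchoose k = (\<Sum>i<n. multichoose a i)"
    unfolding Suc lessThan_Suc_atMost sum_multichoose by (simp add: multichoose_def)
  finally show ?thesis by (simp add: multichoose_def Suc)
qed simp

lemma multichoose_nonneg: "0 \<le> a \<Longrightarrow> 0 \<le> multichoose a n"
proof (induction n rule: less_induct)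
  case (less n)
  then have "0 \<le> real n * multichoose a n"
    unfolding multichoose_rec by (intro mult_nonneg_nonneg sum_nonneg) simp_all
  then show ?case by (cases "n = 0") (simp_all add: zero_le_mult_iff)
qed

text \<open>These are partial sums of \<open>multichoose (a - 1)\<close>, whose terms are
  nonnegative for a at least 1.\<close>

lemma multichoose_mono:
  assumes "1 \<le> a" "m \<le> n"
  shows "multichoose a m \<le> multichoose a n"
proof -
  have "(\<Sum>i\<le>m. multichoose (a - 1) i) \<le> (\<Sum>i\<le>n. multichoose (a - 1) i)"
    using assms by (intro sum_mono2) (simp_all add: multichoose_nonneg)
  then show ?thesis by (simp add: sum_multichoose)
qed

text \<open>B is t F' / F. With the constant term of F fixed at 1, B determines F, and products of
  series become sums.\<close>

definition log_deriv :: "real fps \<Rightarrow> real fps \<Rightarrow> bool" where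
  "log_deriv F B \<longleftrightarrow> F $ 0 = 1 \<and> B $ 0 = 0 \<and> fps_X * fps_deriv F = F * B"

lemma log_deriv_mult:
  assumes "log_deriv F B" "log_deriv G C"
  shows "log_deriv (F * G) (B + C)"
proof -
  have "fps_X * fps_deriv (F * G) = F * (fps_X * fps_deriv G) + (fps_X * fps_deriv F) * G"
    by (simp only: fps_deriv_mult distrib_left mult.assoc mult.left_commute)
  also have "\<dots> = F * (G * C) + (F * B) * G" using assms by (simp only: log_deriv_def)
  also have "\<dots> = (F * G) * (B + C)" by (simp only: algebra_simps)
  finally show ?thesis using assms by (simp add: log_deriv_def)
qed

lemma log_deriv_rec:
  assumes "log_deriv F B"
  shows "real k * F $ k = (\<Sum>i=1..k. B $ i * F $ (k - i))"
proof -
  have "real k * F $ k = (B * F) $ k"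
    using assms fps_X_mult_deriv_nth[of F k] by (simp add: log_deriv_def mult.commute)
  also have "\<dots> = (\<Sum>i=0..k. B $ i * F $ (k - i))" by (simp add: fps_mult_nth)
  also have "\<dots> = (\<Sum>i=1..k. B $ i * F $ (k - i))"
    using assms by (intro sum.mono_neutral_right) (auto simp: log_deriv_def Suc_le_eq)
  finally show ?thesis .
qed

lemma log_deriv_unique:
  assumes "log_deriv F B" "log_deriv G B"
  shows "F = G"
proof (rule fps_ext)
  fix n show "F $ n = G $ n"
  proof (induction n rule: less_induct)
    case (less n)
    have "real n * F $ n = real n * G $ n"
      unfolding log_deriv_rec[OF assms(1)] log_deriv_rec[OF assms(2)]
      by (rule sum.cong) (simp_all add: less)
    then show ?case using assms by (cases "n = 0") (simp_all add: log_deriv_def)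
  qed
qed

text \<open>The power series \<open>(1 - t^p)^(-a)\<close>.\<close>
definition period_fps :: "nat \<Rightarrow> real \<Rightarrow> real fps" where
  "period_fps p a = Abs_fps (\<lambda>n. if p dvd n then multichoose a (n div p) else 0)"

text \<open>The logarithmic derivative is a p t^p / (1 - t^p). Only multiples of p contribute, and
  there the identity reduces to \<open>multichoose_rec\<close>.\<close>

lemma log_deriv_period_fps:
  assumes "0 < p"
  shows "log_deriv (period_fps p a) (Abs_fps (\<lambda>n. if 0 < n \<and> p dvd n then a * real p else 0))"
  unfolding log_deriv_def
proof (intro conjI fps_ext)
  fix n
  let ?c = "\<lambda>n. if 0 < n \<and> p dvd n then a * real p else 0"
  have "(period_fps p a * Abs_fps ?c) $ n
    = (\<Sum>i=0..n. (if p dvd i then multichoose a (i div p) else 0) * ?c (n - i))"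
    by (simp add: fps_mult_nth period_fps_def)
  also have "\<dots> = real n * (if p dvd n then multichoose a (n div p) else 0)"
  proof (cases "p dvd n")
    case True
    then obtain m where n: "n = p * m" by (elim dvdE)
    have "(\<Sum>i=0..n. (if p dvd i then multichoose a (i div p) else 0) * ?c (n - i))
      = (\<Sum>i\<in>(\<lambda>j. p * j) ` {..<m}. multichoose a (i div p) * (a * real p))"
    proof (rule sum.mono_neutral_cong_right)
      show "(\<lambda>j. p * j) ` {..<m} \<subseteq> {0..n}" using assms by (auto simp: n)
      show "\<forall>i\<in>{0..n} - (\<lambda>j. p * j) ` {..<m}. (if p dvd i then multichoose a (i div p) else 0) * ?c (n - i) = 0"
      proof
        fix i assume i: "i \<in> {0..n} - (\<lambda>j. p * j) ` {..<m}"
        have "i = n" if "p dvd i"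
        proof -
          from that obtain j where j: "i = p * j" by (elim dvdE)
          then have "\<not> j < m" using i by auto
          then show ?thesis using i assms by (simp add: j n)
        qed
        then show "(if p dvd i then multichoose a (i div p) else 0) * ?c (n - i) = 0" by auto
      qed
      fix i assume "i \<in> (\<lambda>j. p * j) ` {..<m}"
      then obtain j where j: "i = p * j" "j < m" by auto
      then have "n - i = p * (m - j)" by (simp add: n diff_mult_distrib2)
      then show "(if p dvd i then multichoose a (i div p) else 0) * ?c (n - i) = multichoose a (i div p) * (a * real p)"
        using j assms by simp
    qed simp
    also have "\<dots> = (\<Sum>j<m. multichoose a j * (a * real p))"
      using assms by (subst sum.reindex) (auto simp: inj_on_def)
    also have "\<dots> = real p * (a * (\<Sum>j<m. multichoose a j))"
      by (simp add: sum_distrib_left sum_distrib_right mult_ac)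
    also have "\<dots> = real n * multichoose a m" unfolding multichoose_rec[symmetric] by (simp add: n)
    finally show ?thesis using True assms by (simp add: n)
  next
    case False
    have "(if p dvd i then multichoose a (i div p) else 0) * ?c (n - i) = 0" if "i \<in> {0..n}" for i
    proof -
      have "\<not> (p dvd i \<and> p dvd n - i)" using that False dvd_add[of p i "n - i"] by auto
      then show ?thesis by auto
    qed
    then have "(\<Sum>i=0..n. (if p dvd i then multichoose a (i div p) else 0) * ?c (n - i)) = 0"
      by (rule sum.neutral[OF ballI])
    then show ?thesis using False by (simp only: if_False mult_zero_right)
  qed
  also have "\<dots> = (fps_X * fps_deriv (period_fps p a)) $ n"
    unfolding fps_X_mult_deriv_nth by (simp add: period_fps_def)
  finally show "(fps_X * fps_deriv (period_fps p a)) $ n = (period_fps p a * Abs_fps ?c) $ n" ..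
qed (simp_all add: period_fps_def)

lemma period_fps_1_nth: "period_fps 1 a $ n = multichoose a n"
  by (simp add: period_fps_def)

lemma period_fps_add: "period_fps 1 (x + y) = period_fps 1 x * period_fps 1 y"
proof (rule log_deriv_unique)
  let ?B = "\<lambda>a. Abs_fps (\<lambda>n. if 0 < n \<and> 1 dvd n then a * real 1 else 0)"
  show "log_deriv (period_fps 1 x * period_fps 1 y) (?B x + ?B y)"
    by (intro log_deriv_mult log_deriv_period_fps) simp_all
  have "?B (x + y) = ?B x + ?B y" by (rule fps_ext) simp
  then show "log_deriv (period_fps 1 (x + y)) (?B x + ?B y)"
    using log_deriv_period_fps[of 1 "x + y"] by simp
qed

lemma fps_mult_mono_right:
  fixes F G H :: "real fps"
  assumes "\<And>n. 0 \<le> F $ n" "\<And>n. G $ n \<le> H $ n"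
  shows "(F * G) $ n \<le> (F * H) $ n"
  unfolding fps_mult_nth by (intro sum_mono mult_left_mono assms)

text \<open>
  The factor \<open>(1 - t)^(-1)\<close> available for \<open>M \<ge> 1\<close> turns coefficients into partial sums. Without it the
  comparison fails for \<open>0 < a < 1\<close>, whence the case distinction.
\<close>
lemma period_fps_le:
  assumes "0 \<le> a" "0 < p" "1 \<le> M \<or> (M = 0 \<and> 1 \<le> a)"
  shows "(period_fps 1 M * period_fps p a) $ n \<le> multichoose (M + a) n"
  using assms(3)
proof
  assume M: "1 \<le> M"
  have le: "(period_fps 1 1 * period_fps p a) $ n \<le> (period_fps 1 1 * period_fps 1 a) $ n" for n
  proof -
    have one: "period_fps 1 1 $ i = 1" for i by (simp only: period_fps_1_nth multichoose_one_left)
    have "(period_fps 1 1 * period_fps p a) $ n = (\<Sum>i=0..n. if p dvd i then multichoose a (i div p) else 0)"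
      by (subst mult.commute) (simp only: fps_mult_nth one, simp add: period_fps_def)
    also have "\<dots> = (\<Sum>i\<in>(\<lambda>j. p * j) ` {..n div p}. multichoose a (i div p))"
    proof (rule sum.mono_neutral_cong_right)
      show "(\<lambda>j. p * j) ` {..n div p} \<subseteq> {0..n}"
        using assms(2) by (auto simp: less_eq_div_iff_mult_less_eq mult.commute)
      show "\<forall>i\<in>{0..n} - (\<lambda>j. p * j) ` {..n div p}. (if p dvd i then multichoose a (i div p) else 0) = 0"
        using assms(2) by (auto elim!: dvdE simp: less_eq_div_iff_mult_less_eq mult.commute)
    qed auto
    also have "\<dots> = (\<Sum>j\<le>n div p. multichoose a j)"
      using assms(2) by (subst sum.reindex) (auto simp: inj_on_def)
    also have "\<dots> = multichoose (a + 1) (n div p)" by (rule sum_multichoose)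
    also have "\<dots> \<le> multichoose (a + 1) n"
      using assms(1) by (intro multichoose_mono) (simp_all add: div_le_dividend)
    also have "\<dots> = (period_fps 1 1 * period_fps 1 a) $ n"
      unfolding period_fps_add[symmetric] period_fps_1_nth by (simp add: add.commute)
    finally show ?thesis .
  qed
  have split: "period_fps 1 M = period_fps 1 (M - 1) * period_fps 1 1"
    unfolding period_fps_add[symmetric] by simp
  have "(period_fps 1 (M - 1) * (period_fps 1 1 * period_fps p a)) $ n
    \<le> (period_fps 1 (M - 1) * (period_fps 1 1 * period_fps 1 a)) $ n"
    by (rule fps_mult_mono_right[OF _ le]) (simp only: period_fps_1_nth multichoose_nonneg diff_ge_0_iff_ge M)
  also have "\<dots> = multichoose (M + a) n"
    unfolding period_fps_add[symmetric] period_fps_1_nth by simp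
  finally show ?thesis unfolding split mult.assoc .
next
  assume M: "M = 0 \<and> 1 \<le> a"
  have "period_fps 1 0 = 1" by (rule fps_ext) (simp add: period_fps_1_nth multichoose_zero_left del: One_nat_def)
  then have "(period_fps 1 M * period_fps p a) $ n = (if p dvd n then multichoose a (n div p) else 0)"
    using M by (simp add: period_fps_def)
  also have "\<dots> \<le> multichoose a n"
    using M multichoose_mono[of a "n div p" n] by (simp add: multichoose_nonneg)
  finally show ?thesis using M by simp
qed

text \<open>The assumed power sum bounds are exactly the coefficients of the logarithmic derivative
  of (1 - t)^(-M) (1 - t^p)^(-a), so this product is a majorant.\<close>

lemma norm_elementary_symmetric_le:
  fixes u :: "'i \<Rightarrow> complex"
  assumes "finite D" "0 < p" "0 \<le> a" "1 \<le> M \<or> (M = 0 \<and> 1 \<le> a)"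
    and "\<And>i. 0 < i \<Longrightarrow> norm (\<Sum>x\<in>D. u x ^ i) \<le> M + (if p dvd i then a * real p else 0)"
  shows "norm (\<Sum>T | T \<subseteq> D \<and> card T = k. \<Prod>x\<in>T. u x) \<le> multichoose (M + a) k"
proof -
  let ?F = "period_fps 1 M * period_fps p a"
  let ?b = "\<lambda>i. M + (if p dvd i then a * real p else 0)"
  let ?B = "Abs_fps (\<lambda>n. if 0 < n \<and> 1 dvd n then M * real 1 else 0) + Abs_fps (\<lambda>n. if 0 < n \<and> p dvd n then a * real p else 0)"
  have F: "log_deriv ?F ?B"
    using assms(2) by (intro log_deriv_mult log_deriv_period_fps) simp_all
  have "norm (\<Sum>T | T \<subseteq> D \<and> card T = k. \<Prod>x\<in>T. u x) \<le> ?F $ k"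
  proof (rule newton_majorant)
    fix k show "real k * norm (\<Sum>T | T \<subseteq> D \<and> card T = k. \<Prod>x\<in>T. u x)
      \<le> (\<Sum>i=1..k. norm (\<Sum>x\<in>D. u x ^ i) * norm (\<Sum>T | T \<subseteq> D \<and> card T = k - i. \<Prod>x\<in>T. u x))"
      by (rule norm_elementary_symmetric_newton[OF assms(1)])
    show "real k * ?F $ k = (\<Sum>i=1..k. ?b i * ?F $ (k - i))"
      unfolding log_deriv_rec[OF F] by (intro sum.cong refl) simp
  next
    have "{T. T \<subseteq> D \<and> card T = 0} = {{}}" using assms(1) by (auto dest: finite_subset)
    then show "norm (\<Sum>T | T \<subseteq> D \<and> card T = 0. \<Prod>x\<in>T. u x) \<le> 1" by simp
    show "?F $ 0 = 1" using F by (simp add: log_deriv_def)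
    show "0 \<le> ?b i" for i using assms(3,4) by auto
  qed (use assms(5) in auto)
  also have "\<dots> \<le> multichoose (M + a) k" by (rule period_fps_le[OF assms(3,2,4)])
  finally show ?thesis .
qed

subsection \<open>Counting subset sums\<close>

lemma add_char_sum_subset_le:
  fixes \<psi> :: "'a::{finite,field} \<Rightarrow> complex"
  assumes "add_char \<psi>" "\<psi> z \<noteq> 1" "\<not> CHAR('a) dvd degree f"
  shows "norm (\<Sum>x\<in>D. \<psi> (poly f x)) \<le> (real (degree f) - 1) * sqrt (real (CARD('a))) + real (CARD('a) - card D)"
proof -
  have "(\<Sum>x\<in>D. \<psi> (poly f x)) = (\<Sum>x\<in>UNIV. \<psi> (poly f x)) - (\<Sum>x\<in>-D. \<psi> (poly f x))"
    by (simp add: Compl_eq_Diff_UNIV sum_diff)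
  also have "norm \<dots> \<le> norm (\<Sum>x\<in>UNIV. \<psi> (poly f x)) + norm (\<Sum>x\<in>-D. \<psi> (poly f x))"
    by (rule norm_triangle_ineq4)
  also have "norm (\<Sum>x\<in>-D. \<psi> (poly f x)) \<le> (\<Sum>x\<in>-D. 1)"
    by (rule sum_norm_le) (simp add: add_char_norm[OF assms(1)])
  also have "\<dots> = real (CARD('a) - card D)" by (simp add: Compl_eq_Diff_UNIV card_Diff_subset)
  finally show ?thesis using weil_additive[OF assms] by linarith
qed

lemma subset_sum_count_fourier:
  fixes \<psi> :: "'a::{finite,field} \<Rightarrow> complex"
  assumes \<psi>: "add_char \<psi>" "\<psi> z \<noteq> 1"
  shows "of_nat (CARD('a)) * of_nat (subset_sum_count f D k b)
    = (\<Sum>a\<in>UNIV. \<psi> (- (a * b)) * (\<Sum>T | T \<subseteq> D \<and> card T = k. \<Prod>x\<in>T. \<psi> (a * poly f x)))"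
proof -
  let ?P = "{T. T \<subseteq> D \<and> card T = k}"
  have "(\<Sum>a\<in>UNIV. \<psi> (- (a * b)) * (\<Sum>T\<in>?P. \<Prod>x\<in>T. \<psi> (a * poly f x)))
    = (\<Sum>a\<in>UNIV. \<Sum>T\<in>?P. \<psi> (a * ((\<Sum>x\<in>T. poly f x) - b)))"
  proof (rule sum.cong[OF refl])
    fix a
    have "\<psi> (- (a * b)) * (\<Prod>x\<in>T. \<psi> (a * poly f x)) = \<psi> (a * ((\<Sum>x\<in>T. poly f x) - b))" for T
    proof -
      have "a * ((\<Sum>x\<in>T. poly f x) - b) = - (a * b) + (\<Sum>x\<in>T. a * poly f x)"
        by (simp add: right_diff_distrib sum_distrib_left)
      then show ?thesis by (simp only: add_char_add[OF \<psi>(1)] add_char_sum[OF \<psi>(1)])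
    qed
    then show "\<psi> (- (a * b)) * (\<Sum>T\<in>?P. \<Prod>x\<in>T. \<psi> (a * poly f x)) = (\<Sum>T\<in>?P. \<psi> (a * ((\<Sum>x\<in>T. poly f x) - b)))"
      unfolding sum_distrib_left by (intro sum.cong refl)
  qed
  also have "\<dots> = (\<Sum>T\<in>?P. \<Sum>a\<in>UNIV. \<psi> (a * ((\<Sum>x\<in>T. poly f x) - b)))" by (rule sum.swap)
  also have "\<dots> = (\<Sum>T\<in>?P. if (\<Sum>x\<in>T. poly f x) = b then of_nat (CARD('a)) else 0)"
    by (simp add: add_char_orthogonality[OF \<psi>])
  also have "\<dots> = of_nat (CARD('a)) * of_nat (card {T \<in> ?P. (\<Sum>x\<in>T. poly f x) = b})"
    by (simp flip: sum.inter_filter)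
  also have "{T \<in> ?P. (\<Sum>x\<in>T. poly f x) = b} = {T. T \<subseteq> D \<and> card T = k \<and> (\<Sum>x\<in>T. poly f x) = b}" by blast
  finally show ?thesis by (simp add: subset_sum_count_def)
qed

theorem theorem1p4:
  fixes f :: "'a::{finite,field} poly"
    and D :: "'a set"
    and b :: 'a
    and q p d c k :: nat
  assumes "q = CARD('a)"
    and "p = CHAR('a)"
    and "degree f = d"
    and "\<not> p dvd d"
    and "real (card D) = real q - real c"
    and "real q - real c \<ge> (real d - 1) * sqrt (real q) + real c"
    and "k \<le> card D"
  shows "\<bar>real (subset_sum_count f D k b) - 1 / real q * ((real q - real c) gchoose k)\<bar>
    \<le> ((real q - real c) / real p
         + (real p - 1) / real p * ((real d - 1) * sqrt (real q) + real c)
         + real k - 1) gchoose k"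
proof -
  obtain \<psi> :: "'a \<Rightarrow> complex" where \<psi>: "add_char \<psi>" "\<psi> 1 \<noteq> 1"
    using nontrivial_add_char_exists by blast
  have p: "0 < p" and q: "2 \<le> q"
    using CHAR_gt_1_finite[where 'a='a] CARD_field_ge_2[where 'a='a] assms(1,2) by simp_all
  have c: "c = q - card D" using assms(5) by linarith
  have d: "1 \<le> d" using assms(4) by (cases d) simp_all
  define M where "M = (real d - 1) * sqrt (real q) + real c"
  \<comment> \<open>Chosen so that M + s p = |D|, the trivial bound for the power sums whose index
    is divisible by p.\<close>
  define s where "s = (real (card D) - M) / real p"
  define e where "e a = (\<Sum>T | T \<subseteq> D \<and> card T = k. \<Prod>x\<in>T. \<psi> (a * poly f x))" for a
  have s: "0 \<le> s" using assms(5,6) p by (simp add: s_def M_def)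
  have Ms: "M + s * real p = real (card D)" using p by (simp add: s_def)
  \<comment> \<open>If d > 1 or c > 0 then M is at least 1. Otherwise M = 0 and s = q / p, which is
    at least 1 because q is a positive power of p.\<close>
  have Mcase: "1 \<le> M \<or> (M = 0 \<and> 1 \<le> s)"
  proof (cases "d = 1 \<and> c = 0")
    case True
    then have "M = 0" by (simp add: M_def)
    moreover have "p \<le> q"
    proof -
      obtain t where "q = p ^ t" using CARD_eq_CHAR_power[where 'a='a] assms(1,2) by auto
      with q show ?thesis by (cases t) simp_all
    qed
    then have "1 \<le> s" using True \<open>M = 0\<close> assms(5) p by (simp add: s_def)
    ultimately show ?thesis by simp
  next
    case False
    have sq: "1 \<le> sqrt (real q)" using q by simp
    have "1 \<le> M"
    proof (cases "c = 0")
      case True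
      then have "1 \<le> real d - 1" using False d by simp
      then have "1 * 1 \<le> (real d - 1) * sqrt (real q)" using sq by (intro mult_mono) simp_all
      then show ?thesis using True by (simp add: M_def)
    next
      case False
      have "0 \<le> (real d - 1) * sqrt (real q)" using d by simp
      then show ?thesis using False by (simp add: M_def)
    qed
    then show ?thesis ..
  qed
  have bound: "norm (\<Sum>x\<in>D. \<psi> (a * poly f x) ^ i) \<le> M + (if p dvd i then s * real p else 0)" if "a \<noteq> 0" for a i
  proof -
    \<comment> \<open>An i-th power of a character value is the character at i a f(x). The
      polynomial i a f still has degree d unless p divides i, when it vanishes.\<close>
    have pw: "(\<Sum>x\<in>D. \<psi> (a * poly f x) ^ i) = (\<Sum>x\<in>D. \<psi> (poly (smult (of_nat i * a) f) x))"
      by (simp add: mult.assoc flip: add_char_of_nat_mult[OF \<psi>(1)])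
    show ?thesis
    proof (cases "p dvd i")
      case True
      then have "(of_nat i :: 'a) = 0" using assms(2) by (simp add: of_nat_eq_0_iff_char_dvd)
      then show ?thesis using True unfolding pw by (simp add: add_char_0[OF \<psi>(1)] Ms)
    next
      case False
      then have "(of_nat i :: 'a) \<noteq> 0" using assms(2) by (simp add: of_nat_eq_0_iff_char_dvd)
      with that have deg: "degree (smult (of_nat i * a) f) = d" using assms(3) by simp
      show ?thesis
        using add_char_sum_subset_le[OF \<psi>, of "smult (of_nat i * a) f" D] assms(1,2,4) False
        unfolding deg pw by (simp add: M_def c)
    qed
  qed
  have e: "norm (e a) \<le> multichoose (M + s) k" if "a \<noteq> 0" for a
    unfolding e_def by (rule norm_elementary_symmetric_le[OF finite p s Mcase bound[OF that]])
  have e0: "e 0 = of_nat (card D choose k)"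
    by (simp add: e_def add_char_0[OF \<psi>(1)] n_subsets)
  have "of_nat q * of_nat (subset_sum_count f D k b) = (\<Sum>a\<in>UNIV. \<psi> (- (a * b)) * e a)"
    unfolding assms(1) e_def by (rule subset_sum_count_fourier[OF \<psi>])
  also have "\<dots> = e 0 + (\<Sum>a\<in>UNIV - {0}. \<psi> (- (a * b)) * e a)"
    by (subst sum.remove[of UNIV 0]) (simp_all add: add_char_0[OF \<psi>(1)])
  finally have main: "of_nat q * of_nat (subset_sum_count f D k b) - of_nat (card D choose k)
    = (\<Sum>a\<in>UNIV - {0}. \<psi> (- (a * b)) * e a)" unfolding e0 by simp
  have "\<bar>real q * real (subset_sum_count f D k b) - real (card D choose k)\<bar>
    = norm (of_nat q * of_nat (subset_sum_count f D k b) - of_nat (card D choose k) :: complex)"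
    by (metis norm_of_real of_real_diff of_real_mult of_real_of_nat_eq)
  also have "\<dots> \<le> (\<Sum>a\<in>UNIV - {0::'a}. multichoose (M + s) k)"
    unfolding main by (rule sum_norm_le) (simp add: norm_mult add_char_norm[OF \<psi>(1)] e)
  also have "\<dots> = real (q - 1) * multichoose (M + s) k"
    by (simp add: assms(1) card_Diff_singleton)
  \<comment> \<open>Enlarging the q - 1 nontrivial characters to q makes the factor cancel on
    division by q.\<close>
  also have "\<dots> \<le> real q * multichoose (M + s) k"
    using Mcase s by (intro mult_right_mono multichoose_nonneg) auto
  finally have "\<bar>real q * real (subset_sum_count f D k b) - real (card D choose k)\<bar> \<le> real q * multichoose (M + s) k" .
  then have "\<bar>real (subset_sum_count f D k b) - 1 / real q * real (card D choose k)\<bar> \<le> multichoose (M + s) k"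
    using q by (simp add: abs_le_iff field_simps)
  moreover have "real (card D choose k) = (real q - real c) gchoose k"
    by (simp add: binomial_gbinomial assms(5))
  moreover have "M + s = (real q - real c) / real p + (real p - 1) / real p * M"
    using p assms(5) by (simp add: s_def field_simps)
  ultimately show ?thesis by (simp add: multichoose_def M_def)
qed

end
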